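(* Let $G_{13}$ be the graph with graph6 string \texttt{L?bFFbw\textasciitilde B\{FwFw}, i.e. the graph on vertex set $\{0,1,\dots,12\}$ in which $i$ and $j$ are adjacent if and only if $4\le |i-j|\le 9$. Then: (1) $G_{13}$ is a $6$-regular $4$-vertex-critical graph on $13$ vertices, and every $6$-regular $4$-vertex-critical graph on $n\le 15$ vertices is isomorphic to $G_{13}$ (so there is none with $n\le 15$, $n\neq 13$, and exactly one up to isomorphism with $n=13$). (2) $G_{13}$ has exactly $13$ critical edges, and they form a Hamilton cycle of $G_{13}$. (3) Consequently, every $6$-regular $(4,1)$-graph has at least $16$ vertices.
   Context: All graphs are finite and simple. A graph $G$ is $k$-vertex-critical if $\chi(G)=k$ and $\chi(G-v)=k-1$ for every vertex $v$. An edge $e$ of $G$ is critical if $\chi(G-e)<\chi(G)$. A $(4,1)$-graph is a graph $G$ with $\chi(G)=4$, $\chi(G-v)=3$ for every vertex $v$, and $\chi(G-e)=4$ for every edge $e$. The explicit adjacency rule given for $G_{13}$ is the decoding of the graph6 string. *)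

theory Defs
  imports Main
begin

text \<open>Finite simple graphs, with edges as two-element sets of vertices.\<close>

record 'a ugraph =
  verts :: "'a set"
  edges :: "'a set set"

definition simple_graph :: "'a ugraph \<Rightarrow> bool" where
  "simple_graph G \<longleftrightarrow>
     finite (verts G) \<and>
     edges G \<subseteq> {{u, v} | u v. u \<in> verts G \<and> v \<in> verts G \<and> u \<noteq> v}"

definition degree :: "'a ugraph \<Rightarrow> 'a \<Rightarrow> nat" where
  "degree G v = card {e \<in> edges G. v \<in> e}"

definition regular :: "nat \<Rightarrow> 'a ugraph \<Rightarrow> bool" where
  "regular d G \<longleftrightarrow> (\<forall>v\<in>verts G. degree G v = d)"

definition del_vertex :: "'a ugraph \<Rightarrow> 'a \<Rightarrow> 'a ugraph" where
  "del_vertex G v = \<lparr>verts = verts G - {v}, edges = {e \<in> edges G. v \<notin> e}\<rparr>"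

definition del_edge :: "'a ugraph \<Rightarrow> 'a set \<Rightarrow> 'a ugraph" where
  "del_edge G e = \<lparr>verts = verts G, edges = edges G - {e}\<rparr>"

definition isomorphic :: "'a ugraph \<Rightarrow> 'b ugraph \<Rightarrow> bool" where
  "isomorphic G H \<longleftrightarrow>
     (\<exists>f. bij_betw f (verts G) (verts H) \<and>
          (\<forall>u\<in>verts G. \<forall>v\<in>verts G. {u, v} \<in> edges G \<longleftrightarrow> {f u, f v} \<in> edges H))"

definition proper_colouring :: "'a ugraph \<Rightarrow> nat \<Rightarrow> ('a \<Rightarrow> nat) \<Rightarrow> bool" where
  "proper_colouring G k c \<longleftrightarrow>
     (\<forall>v\<in>verts G. c v < k) \<and>
     (\<forall>u\<in>verts G. \<forall>v\<in>verts G. {u, v} \<in> edges G \<longrightarrow> c u \<noteq> c v)"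

definition chromatic_number :: "'a ugraph \<Rightarrow> nat" where
  "chromatic_number G = (LEAST k. \<exists>c. proper_colouring G k c)"

definition vertex_critical :: "nat \<Rightarrow> 'a ugraph \<Rightarrow> bool" where
  "vertex_critical k G \<longleftrightarrow>
     chromatic_number G = k \<and>
     (\<forall>v\<in>verts G. chromatic_number (del_vertex G v) = k - 1)"

definition critical_edges :: "'a ugraph \<Rightarrow> 'a set set" where
  "critical_edges G =
     {e \<in> edges G. chromatic_number (del_edge G e) < chromatic_number G}"

definition graph_4_1 :: "'a ugraph \<Rightarrow> bool" where
  "graph_4_1 G \<longleftrightarrow>
     chromatic_number G = 4 \<and>
     (\<forall>v\<in>verts G. chromatic_number (del_vertex G v) = 3) \<and>
     (\<forall>e\<in>edges G. chromatic_number (del_edge G e) = 4)"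

text \<open>A Hamilton cycle is represented by its set of edges; the list enumerates the
  vertices in cyclic order.\<close>

definition hamilton_cycle :: "'a ugraph \<Rightarrow> 'a set set \<Rightarrow> bool" where
  "hamilton_cycle G C \<longleftrightarrow>
     C \<subseteq> edges G \<and>
     (\<exists>vs. distinct vs \<and> set vs = verts G \<and> length vs \<ge> 3 \<and>
           C = {{vs ! i, vs ! (Suc i mod length vs)} | i. i < length vs})"

text \<open>The graph with graph6 string \<open>L?bFFbw~B{FwFw\<close>.\<close>

definition G13 :: "nat ugraph" where
  "G13 = \<lparr>verts = {0..12},
          edges = {{i, j} | i j. i \<in> {0..12} \<and> j \<in> {0..12} \<and>
                     4 \<le> \<bar>int i - int j\<bar> \<and> \<bar>int i - int j\<bar> \<le> 9}\<rparr>"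

end

theory Submission
  imports Defs "HOL-Library.Multiset"
begin

text \<open>
  Let \<open>G\<close> be a 6-regular 4-vertex-critical graph on \<open>n \<le> 15\<close> vertices. Every
  vertex of \<open>G\<close> has exactly \<open>n - 7 \<le> 8\<close> non-neighbours, and this small budget is
  what the proof exhausts. Non-neighbours come from two sources: a largest independent set \<open>I\<close>,
  and, for every vertex \<open>w\<close>, a 3-colouring of \<open>G - w\<close>, whose colour classes are
  independent sets of at most \<open>\<bar>I\<bar>\<close> vertices.

  Suppose that some of these colourings have been chosen. Nothing distinguishes two vertices that lie on the
  same side of \<open>I\<close> and have the same colour in each of them, so the situation is described by a
  list of cells, each with the number of its vertices and with its slack, the number of non-neighbours that each
  of its vertices still lacks. Choosing a further colouring splits every cell into three parts, which can be
  done in few ways, because every new part uses up the slack of the parts with the same colour. A branch ends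
  when the slack becomes negative, when a colour class outgrows \<open>I\<close>, or when the non-adjacencies
  found so far suffice to 3-colour all of \<open>G\<close>, which contradicts the chromatic number 4
  (\<open>tricol_correct\<close>). The neighbours of a vertex in \<open>I\<close> lie outside \<open>I\<close>
  and three colour classes cover all vertices but one, so \<open>\<bar>I\<bar> + 6 \<le> n \<le> 3 *
  \<bar>I\<bar> + 1\<close>, which leaves 21 pairs \<open>(n, \<bar>I\<bar>)\<close>. For each of them the tree
  of all choices is finite and small enough to be traversed by rewriting, and all its branches end in this way,
  with two exceptions for \<open>n = 13\<close> and \<open>\<bar>I\<bar> = 4\<close>. In these two all cells
  have become single vertices without slack, so that the recorded non-adjacencies are all there are:
  \<open>G\<close> is determined, and both times it is \<open>G13\<close> (\<open>small_critical_graph\<close>).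

  An extremal choice keeps the trees small. Call the largest number of vertices of \<open>I\<close> with the
  same colour the concentration of a colouring. The first colouring is taken of least concentration among the
  3-colourings of all \<open>G - a\<close> with \<open>a \<in> I\<close>, and later colourings of this kind with
  a smaller concentration need not be followed (\<open>search_correct\<close>). The search itself is a recursive
  function. That it overlooks nothing rests on \<open>spread_correct\<close>: up to a permutation of the
  colours, each 3-colouring of \<open>G - w\<close> is among the enumerated ways to split the cells.

  In \<open>G13\<close> the vertices form a cycle of length 13 in which adjacent means at distance 4, 5 or 6.
  Five consecutive vertices contain only one adjacent pair, namely the two ends, and four contain none. Cutting
  the cycle into arcs of 5, 4 and 4 vertices therefore 3-colours the graph without one edge, and also without
  either end of that edge (\<open>arc_near\<close>). So the 13 edges at distance 4 are critical, and since 4 is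
  prime to 13 they form a Hamilton cycle. Removing any of the other 26 edges leaves a graph without 3-colouring,
  by exhausting the attempts to colour it (\<open>long_edges_stuck\<close>). As \<open>G13\<close> has critical
  edges, it is no \<open>(4,1)\<close>-graph, and hence neither is any 6-regular graph with at most 15 vertices.
\<close>

section \<open>Splitting cells by 3-colourings\<close>

text \<open>\<open>Blank\<close> marks the deleted vertex of a 3-colouring of a vertex-deleted subgraph.\<close>

datatype colour = Blank | Red | Green | Blue

text \<open>A history lists the colours that a vertex has received, the latest first. Two vertices with a common
  true colour at the same position are not adjacent.\<close>

fun agree :: "colour list \<Rightarrow> colour list \<Rightarrow> bool" where
  "agree (Red # h) (Red # h') = True"
| "agree (Green # h) (Green # h') = True"
| "agree (Blue # h) (Blue # h') = True"
| "agree (_ # h) (_ # h') = agree h h'"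
| "agree _ _ = False"

fun linked :: "bool \<Rightarrow> colour list \<Rightarrow> bool \<Rightarrow> colour list \<Rightarrow> bool" where
  "linked True h True h' = True"
| "linked False h i h' = agree h h'"
| "linked True h False h' = agree h h'"

text \<open>In \<open>Cell n s i h\<close>, \<open>n\<close> is the number of vertices and \<open>s\<close> the
  slack; \<open>i\<close> says whether they lie in the independent set \<open>I\<close>, and \<open>h\<close> is
  their history.\<close>

datatype cell = Cell nat nat bool "colour list"

text \<open>A partly enumerated colouring: in \<open>Trio a b c X Y Z\<close>, the lists \<open>X\<close>,
  \<open>Y\<close>, \<open>Z\<close> are the three colour classes as lists of cells, and \<open>a\<close>,
  \<open>b\<close>, \<open>c\<close> say how many further vertices each class can take. The histories are still
  those before this colouring.\<close>

datatype trio = Trio nat nat nat "cell list" "cell list" "cell list"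

text \<open>All vertices of one colour class are pairwise non-adjacent, so a new cell costs slack for each cell
  of the class that is not yet linked to it, and conversely. The result is \<open>None\<close> if some slack
  does not suffice.\<close>

fun put :: "nat \<Rightarrow> nat \<Rightarrow> bool \<Rightarrow> colour list \<Rightarrow> cell list \<Rightarrow> cell list \<Rightarrow> cell list option" where
  "put a s i h acc [] = Some (Cell a s i h # acc)"
| "put a s i h acc (Cell a' s' i' h' # cs) =
     (if linked i h i' h' then put a s i h (Cell a' s' i' h' # acc) cs
      else if a' \<le> s \<and> a \<le> s' then put a (s - a') i h (Cell a' (s' - a) i' h' # acc) cs
      else None)"

text \<open>If the vertices of the new cell are not linked to each other, then each of them also spends \<open>a
  - 1\<close> of its slack inside the cell.\<close>

definition add :: "nat \<Rightarrow> nat \<Rightarrow> bool \<Rightarrow> colour list \<Rightarrow> cell list \<Rightarrow> cell list option" where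
  "add a s i h cs = (if a = 0 then Some cs
     else if linked i h i h then put a s i h [] cs
     else if a - 1 \<le> s then put a (s - (a - 1)) i h [] cs else None)"

definition place :: "nat \<times> nat \<times> nat \<Rightarrow> nat \<Rightarrow> bool \<Rightarrow> colour list \<Rightarrow> trio \<Rightarrow> trio option" where
  "place t s i h u = (case (t, u) of ((x, y, z), Trio a b c X Y Z) \<Rightarrow>
     if x \<le> a \<and> y \<le> b \<and> z \<le> c then
       (case (add x s i h X, add y s i h Y, add z s i h Z) of
          (Some X', Some Y', Some Z') \<Rightarrow> Some (Trio (a - x) (b - y) (c - z) X' Y' Z') | _ \<Rightarrow> None)
     else None)"

text \<open>The colours are interchangeable until they are used. With \<open>m\<close> colours in use, those
  that the present cell opens can be taken in order of decreasing numbers of its vertices; \<open>opened\<close>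
  is the number of colours in use afterwards.\<close>

definition ordered :: "nat \<Rightarrow> nat \<times> nat \<times> nat \<Rightarrow> bool" where
  "ordered m t = (case t of (x, y, z) \<Rightarrow> (m = 0 \<longrightarrow> y \<le> x) \<and> (m \<le> 1 \<longrightarrow> z \<le> y))"

definition opened :: "nat \<Rightarrow> nat \<times> nat \<times> nat \<Rightarrow> nat" where
  "opened m t = (case t of (x, y, z) \<Rightarrow> if 0 < z then 3 else if 0 < y then max m 2 else max m 1)"

text \<open>\<open>splits n\<close> lists the triples of sum \<open>n\<close>; the accumulators spare the
  concatenation of lists.\<close>

fun rows :: "nat \<Rightarrow> nat \<Rightarrow> nat \<Rightarrow> (nat \<times> nat \<times> nat) list \<Rightarrow> (nat \<times> nat \<times> nat) list" where
  "rows x 0 z acc = (x,0,z) # acc" | "rows x (Suc y) z acc = rows x y (Suc z) ((x,Suc y,z) # acc)"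

fun triples :: "nat \<Rightarrow> nat \<Rightarrow> (nat \<times> nat \<times> nat) list \<Rightarrow> (nat \<times> nat \<times> nat) list" where
  "triples 0 r acc = rows 0 r 0 acc" | "triples (Suc x) r acc =
      triples x (Suc r) (rows (Suc x) r 0 acc)"

definition splits :: "nat \<Rightarrow> (nat \<times> nat \<times> nat) list" where "splits n = triples n 0 []"

fun spread :: "cell list \<Rightarrow> nat \<Rightarrow> trio \<Rightarrow> trio list" where
  "spread [] m u = [u]"
| "spread (Cell n s i h # cs) m u = concat (map (\<lambda>t. if ordered m t then
      (case place t s i h u of None \<Rightarrow> [] | Some u' \<Rightarrow> spread cs (opened m t) u') else []) (splits n))"

fun fits :: "bool \<Rightarrow> colour list \<Rightarrow> cell list \<Rightarrow> bool" where
  "fits i h [] = True"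
| "fits i h (Cell n s i' h' # cs) = (linked i h i' h' \<and> fits i h cs)"

text \<open>Tries to partition all vertices into three sets of pairwise linked vertices, keeping cells together;
  a cell of several vertices can only be used if they are linked to each other.\<close>

fun tricol :: "cell list \<Rightarrow> cell list \<Rightarrow> cell list \<Rightarrow> cell list \<Rightarrow> bool" where
  "tricol [] X Y Z = True"
| "tricol (Cell n s i h # cs) X Y Z = ((n = 1 \<or> linked i h i h) \<and>
     (fits i h X \<and> tricol cs (Cell n s i h # X) Y Z \<or>
      X \<noteq> [] \<and> (fits i h Y \<and> tricol cs X (Cell n s i h # Y) Z \<or>
      Y \<noteq> [] \<and> fits i h Z \<and> tricol cs X Y (Cell n s i h # Z))))"

text \<open>The order in which cells are split affects only the size of the search tree. It is best when
  contradictions show up early: after each cell the remaining ones are sorted stably, first those unlinked to it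
  of which one of the two has no slack, then the other unlinked ones, then the linked ones.\<close>

fun sift :: "cell \<Rightarrow> cell list \<Rightarrow> cell list \<Rightarrow> cell list \<Rightarrow> cell list \<Rightarrow> cell list" where
  "sift c [] X Y Z = rev X @ rev Y @ rev Z"
| "sift (Cell n s i h) (Cell n' s' i' h' # cs) X Y Z =
     (if linked i h i' h' then sift (Cell n s i h) cs X Y (Cell n' s' i' h' # Z)
      else if s = 0 \<or> s' = 0 then sift (Cell n s i h) cs (Cell n' s' i' h' # X) Y Z
      else sift (Cell n s i h) cs X (Cell n' s' i' h' # Y) Z)"

fun chain :: "cell list \<Rightarrow> cell list \<Rightarrow> cell list" where
  "chain fs [] = []" | "chain [] (c # cs) = c # cs" |
      "chain (f # fs) (c # cs) = c # chain fs (sift c cs [] [] [])"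

fun insert_cell :: "cell \<Rightarrow> cell list \<Rightarrow> cell list" where
  "insert_cell c [] = [c]"
| "insert_cell (Cell n s i h) (Cell n' s' i' h' # cs) =
    (if s' < s then Cell n' s' i' h' # insert_cell (Cell n s i h) cs
        else Cell n s i h # Cell n' s' i' h' # cs)"

definition arrange :: "cell list \<Rightarrow> cell list" where
  "arrange cs = chain cs (foldr insert_cell cs [])"

text \<open>No vertex is deleted twice, so that a history contains at most one \<open>Blank\<close>.\<close>

fun undone :: "colour list \<Rightarrow> bool" where
  "undone [] = True"
| "undone (Blank # h) = False"
| "undone (_ # h) = undone h"

fun pickR :: "cell list \<Rightarrow> cell list \<Rightarrow> (cell \<times> cell list) option" where
  "pickR acc [] = None"
| "pickR acc (Cell n s i h # cs) = (if 0 < s \<and> undone h then Some (Cell n s i h, acc @ cs)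
  else pickR (Cell n s i h # acc) cs)"

text \<open>The next vertex to delete is one of \<open>I\<close> of least slack, as long as there is one that
  has not been deleted, and afterwards any other vertex with positive slack.\<close>

fun pick :: "cell option \<Rightarrow> cell list \<Rightarrow> cell list \<Rightarrow> (cell \<times> cell list) option" where
  "pick None acc [] = pickR [] acc"
| "pick (Some c) acc [] = Some (c, acc)"
| "pick None acc (Cell n s i h # cs) = (if i \<and> undone h then pick (Some (Cell n s i h)) acc cs
  else pick None (Cell n s i h # acc) cs)"
| "pick (Some (Cell n s i h)) acc (Cell n' s' i' h' # cs) = (if i' \<and> s' < s \<and> undone h'
  then pick (Some (Cell n' s' i' h')) (Cell n s i h # acc) cs
     else pick (Some (Cell n s i h)) (Cell n' s' i' h' # acc) cs)"

fun less1 :: "cell \<Rightarrow> cell list \<Rightarrow> cell list" where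
  "less1 (Cell n s i h) cs = (if n \<le> 1 then cs else Cell (n - 1) s i h # cs)"

definition extensions :: "nat \<Rightarrow> cell \<Rightarrow> cell list \<Rightarrow> trio list" where
  "extensions al c cs = spread (arrange (less1 c cs)) 0 (Trio al al al [] [] [])"

fun paint :: "colour \<Rightarrow> cell \<Rightarrow> cell" where
  "paint k (Cell n s i h) = Cell n s i (k # h)"

text \<open>The classes are interleaved because \<open>tricol\<close> finds contradictions sooner if consecutive
  cells have different colours.\<close>

fun weave :: "cell list \<Rightarrow> cell list \<Rightarrow> cell list \<Rightarrow> cell list \<Rightarrow> cell list" where
  "weave (x # xs) (y # ys) (z # zs) w = paint Red x # paint Green y # paint Blue z # weave xs ys zs w"
| "weave [] (y # ys) zs w = paint Green y # weave [] ys zs w"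
| "weave (x # xs) [] zs w = paint Red x # weave xs [] zs w"
| "weave (x # xs) (y # ys) [] w = paint Red x # paint Green y # weave xs ys [] w"
| "weave [] [] (z # zs) w = paint Blue z # weave [] [] zs w"
| "weave [] [] [] w = w"

text \<open>The deleted vertex becomes a cell of its own, which gains no new links.\<close>

fun record_colouring :: "cell \<Rightarrow> trio \<Rightarrow> cell list" where
  "record_colouring (Cell n s i h) (Trio a b c X Y Z) = weave X Y Z [Cell 1 s i (Blank # h)]"

fun count_I :: "cell list \<Rightarrow> nat" where
  "count_I [] = 0" | "count_I (Cell n s i h # cs) = (if i then n + count_I cs else count_I cs)"

fun trio_concentration :: "trio \<Rightarrow> nat" where
  "trio_concentration (Trio a b c X Y Z) = max (count_I X) (max (count_I Y) (count_I Z))"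

text \<open>Colourings that delete a vertex of \<open>I\<close> and have concentration less than
  \<open>r\<close> are excluded by the extremal choice of the first colouring.\<close>

fun small :: "nat \<Rightarrow> cell \<Rightarrow> trio \<Rightarrow> bool" where
  "small r (Cell n s i h) u = (i \<and> trio_concentration u < r)"

text \<open>\<open>f\<close> bounds the number of further colourings. Where no vertex is left to be picked, only
  a state from \<open>Ls\<close> is accepted.\<close>

fun refuted :: "nat \<Rightarrow> nat \<Rightarrow> nat \<Rightarrow> cell list list \<Rightarrow> cell list \<Rightarrow> bool" where
  "refuted 0 al r Ls cs = (cs \<in> set Ls)"
| "refuted (Suc f) al r Ls cs = (tricol cs [] [] [] \<or> (case pick None [] cs of None \<Rightarrow> cs \<in> set Ls
     | Some (c, cs') \<Rightarrow> list_all (\<lambda>u. small r c u \<or> refuted f al r Ls (record_colouring c u))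
         (extensions al c cs')))"

text \<open>Each vertex of \<open>I\<close> knows the \<open>al - 1\<close> others as non-neighbours from the
  start.\<close>

definition start_cell :: "nat \<Rightarrow> nat \<Rightarrow> cell" where
  "start_cell n al = Cell al (n - 7 - (al - 1)) True []"

text \<open>\<open>r\<close> is the concentration of the first colouring, which deletes a vertex of
  \<open>I\<close>. Ten further colourings are enough for all trees that occur below.\<close>

definition search :: "nat \<Rightarrow> nat \<Rightarrow> cell list list \<Rightarrow> nat \<Rightarrow> bool" where
  "search n al Ls r = list_all (\<lambda>u. trio_concentration u \<noteq> r \<or>
      refuted 10 al r Ls (record_colouring (start_cell n al) u))
     (extensions al (start_cell n al) [Cell (n - al) (n - 7) False []])"

section \<open>Rewrite rules for evaluating the search\<close>

text \<open>The simplifier evaluates a call quickly if the arguments are in normal form and the defining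
  equations match on constructors; a conditional or a case distinction with large branches is slow, since its
  branches are traversed again and again. Each test is therefore handed as an evaluated argument to an auxiliary
  function, whose equations choose the branch. The functions below only serve this purpose; their definitions
  repeat the corresponding piece of the specification.\<close>

fun lt :: "nat \<Rightarrow> nat \<Rightarrow> bool" where
  "lt n 0 = False"
| "lt 0 (Suc m) = True"
| "lt (Suc n) (Suc m) = lt n m"

lemma lt_iff: "lt n m \<longleftrightarrow> n < m" by (induction n m rule: lt.induct) auto

fun sub :: "nat \<Rightarrow> nat \<Rightarrow> nat option" where
  "sub n 0 = Some n" | "sub 0 (Suc m) = None" | "sub (Suc n) (Suc m) = sub n m"

lemma sub_eq: "sub n m = (if m \<le> n then Some (n - m) else None)"
  by (induction n m rule: sub.induct) auto

definition put1 where "put1 b a s i h acc a' s' i' h' cs = (if b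
  then put a s i h (Cell a' s' i' h' # acc) cs
      else if a' \<le> s \<and> a \<le> s' then put a (s - a') i h (Cell a' (s' - a) i' h' # acc) cs else None)"

definition put2 where
  "put2 u v a i h acc a' i' h' cs =
    (case u of None \<Rightarrow> None | Some t \<Rightarrow>
     (case v of None \<Rightarrow> None | Some t' \<Rightarrow> put a t i h (Cell a' t' i' h' # acc) cs))"

lemma [code]:
  "put a s i h acc [] = Some (Cell a s i h # acc)"
  "put a s i h acc (Cell a' s' i' h' # cs) = put1 (linked i h i' h') a s i h acc a' s' i' h' cs"
 by (simp_all add: put1_def)

lemma [code]:
  "put1 True a s i h acc a' s' i' h' ps = put a s i h (Cell a' s' i' h' # acc) ps"
  "put1 False (Suc 0) (Suc s) i h acc (Suc 0) (Suc s') i' h' ps =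
      put (Suc 0) s i h (Cell (Suc 0) s' i' h' # acc) ps"
  "put1 False (Suc 0) 0 i h acc (Suc 0) s' i' h' ps = None"
  "put1 False (Suc 0) (Suc s) i h acc (Suc 0) 0 i' h' ps = None"
  "put1 False (Suc (Suc a)) s i h acc a' s' i' h' ps =
      put2 (sub s a') (sub s' (Suc (Suc a))) (Suc (Suc a)) i h acc a' i' h' ps"
  "put1 False 0 s i h acc a' s' i' h' ps = put2 (sub s a') (sub s' 0) 0 i h acc a' i' h' ps"
  "put1 False (Suc 0) s i h acc (Suc (Suc a')) s' i' h' ps =
      put2 (sub s (Suc (Suc a'))) (sub s' (Suc 0)) (Suc 0) i h acc (Suc (Suc a')) i' h' ps"
  "put1 False (Suc 0) s i h acc 0 s' i' h' ps =
      put2 (sub s 0) (sub s' (Suc 0)) (Suc 0) i h acc 0 i' h' ps"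
 by (simp_all add: put1_def put2_def sub_eq)

lemma [code]:
  "put2 (Some t) (Some t') a i h acc a' i' h' ps = put a t i h (Cell a' t' i' h' # acc) ps"
  "put2 None v a i h acc a' i' h' ps = None"
  "put2 (Some t) None a i h acc a' i' h' ps = None"
 by (simp_all add: put2_def)

definition add1 where
  "add1 b a s i h cs = (if b then put (Suc (Suc a)) s i h [] cs else if Suc a \<le> s
      then put (Suc (Suc a)) (s - Suc a) i h [] cs else None)"

definition add2 where
  "add2 u a i h cs =
    (case u of None \<Rightarrow> None | Some t \<Rightarrow> put (Suc (Suc a)) t i h [] cs)"

lemma [code]:
  "add 0 s i h cs = Some cs"
  "add (Suc 0) s i h cs = put (Suc 0) s i h [] cs"
  "add (Suc (Suc a)) s i h cs = add1 (linked i h i h) a s i h cs"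
  by (simp_all add: add_def add1_def)

lemma [code]:
  "add1 True a s i h cs = put (Suc (Suc a)) s i h [] cs"
  "add1 False a s i h cs = add2 (sub s (Suc a)) a i h cs"
  by (simp_all add: add1_def add2_def sub_eq)

lemma [code]:
  "add2 None a i h cs = None"
  "add2 (Some t) a i h cs = put (Suc (Suc a)) t i h [] cs"
  by (simp_all add: add2_def)

text \<open>Instead of a list of all extensions that is checked afterwards, the extensions are checked as they
  are produced, so that no long list is ever rewritten.\<close>

definition "good f al r Ls c u = (small r c u \<or> refuted f al r Ls (record_colouring c u))"

definition "goodp f al r Ls c m cs u = list_all (good f al r Ls c) (spread cs m u)"

definition
  "goodo f al r Ls c m cs q = (case q of None \<Rightarrow> True | Some u \<Rightarrow> goodp f al r Ls c m cs u)"

definition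
  "tries f al r Ls c m cs s i h u ts = list_all (\<lambda>t. ordered m t \<longrightarrow>
      goodo f al r Ls c (opened m t) cs (place t s i h u)) ts"

lemma goodp_Nil: "goodp f al r Ls c m [] u = good f al r Ls c u" by (simp add: goodp_def)

lemma goodp_Cons: "goodp f al r Ls c m (Cell n s i h # cs) u =
  tries f al r Ls c m cs s i h u (splits n)"
proof -
  let ?P = "good f al r Ls c"
  have 1: "list_all ?P (concat (map F ts)) = list_all (\<lambda>t. list_all ?P (F t)) ts" for F
    and ts :: "(nat \<times> nat \<times> nat) list"
    by (induction ts) auto
  have "(\<lambda>t. list_all ?P (if ordered m t
    then (case place t s i h u of None \<Rightarrow> [] | Some u' \<Rightarrow> spread cs (opened m t) u') else []))
    = (\<lambda>t. ordered m t \<longrightarrow> goodo f al r Ls c (opened m t) cs (place t s i h u))"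
    by (rule ext) (auto simp: goodo_def goodp_def split: option.split)
  then show ?thesis unfolding goodp_def spread.simps 1 tries_def by simp
qed

lemma set_rows: "set (rows x y z acc) = {(x, y', z') | y' z'. y' + z' = y + z \<and> y' \<le> y} \<union> set acc"
proof (induction x y z acc rule: rows.induct)
  case (2 x y z acc)
  have "y' + z' = y + Suc z \<and> y' \<le> y \<or> y' = Suc y \<and> z' = z \<longleftrightarrow> y' + z' = Suc y + z \<and> y' \<le> Suc y" for y' z'
    by auto
  then show ?case using 2 by (auto; blast)
qed auto

lemma set_triples: "set (triples x r acc) = {(x', y', z') | x' y' z'. x' + y' + z' = x + r \<and> x' \<le> x} \<union>
  set acc"
proof (induction x r acc rule: triples.induct)
  case (1 r acc) then show ?case by (auto simp: set_rows)
next
  case (2 x r acc)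
  have "x' + y' + z' = x + Suc r \<and> x' \<le> x \<or> x' = Suc x \<and> y' + z' = r \<longleftrightarrow> x' + y' + z' = Suc x + r \<and>
    x' \<le> Suc x" for x' y' z' :: nat by auto
  then show ?case using 2 by (auto simp: set_rows; blast)
qed

lemma set_splits: "set (splits n) = {(x, y, z) | x y z. x + y + z = n}"
  by (auto simp: splits_def set_triples)

definition pickR1 where
  "pickR1 b acc n s i h cs = (if b then Some (Cell n s i h, acc @ cs)
      else pickR (Cell n s i h # acc) cs)"

definition conj2 :: "bool \<Rightarrow> bool \<Rightarrow> bool" where "conj2 a b = (a \<and> b)"

lemma [code]:
  "conj2 True b = b" "conj2 False b = False" by (simp_all add: conj2_def)

lemma [code]:
  "pickR1 True acc n s i h cs = Some (Cell n s i h, acc @ cs)"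
  "pickR1 False acc n s i h cs = pickR (Cell n s i h # acc) cs"
  by (simp_all add: pickR1_def)

lemma [code]:
  "pickR acc [] = None"
  "pickR acc (Cell n 0 i h # cs) = pickR (Cell n 0 i h # acc) cs"
  "pickR acc (Cell n (Suc s) i h # cs) = pickR1 (undone h) acc n (Suc s) i h cs"
  by (simp_all add: pickR1_def)

definition pick1 where
  "pick1 b acc n s i h cs = (if b then pick (Some (Cell n s i h)) acc cs
      else pick None (Cell n s i h # acc) cs)"

definition pick2 where
  "pick2 b n s i h acc n' s' i' h' cs = (if b
      then pick (Some (Cell n' s' i' h')) (Cell n s i h # acc) cs
     else pick (Some (Cell n s i h)) (Cell n' s' i' h' # acc) cs)"

lemma [code]:
  "pick1 True acc n s i h cs = pick (Some (Cell n s i h)) acc cs"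
  "pick1 False acc n s i h cs = pick None (Cell n s i h # acc) cs"
  by (simp_all add: pick1_def)

lemma [code]:
  "pick2 True n s i h acc n' s' i' h' cs = pick (Some (Cell n' s' i' h')) (Cell n s i h # acc) cs"
  "pick2 False n s i h acc n' s' i' h' cs = pick (Some (Cell n s i h)) (Cell n' s' i' h' # acc) cs"
  by (simp_all add: pick2_def)

lemma [code]:
  "pick None acc [] = pickR [] acc" "pick (Some c) acc [] = Some (c, acc)"
  "pick None acc (Cell n s False h # cs) = pick None (Cell n s False h # acc) cs"
  "pick None acc (Cell n s True h # cs) = pick1 (undone h) acc n s True h cs"
  "pick (Some (Cell n s i h)) acc (Cell n' s' True h' # cs) =
      pick2 (conj2 (lt s' s) (undone h')) n s i h acc n' s' True h' cs"
  "pick (Some (Cell n s i h)) acc (Cell n' s' False h' # cs) =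
      pick (Some (Cell n s i h)) (Cell n' s' False h' # acc) cs"
  by (simp_all add: pick1_def pick2_def lt_iff conj2_def)

fun rigid :: "nat \<Rightarrow> nat \<Rightarrow> bool" where
  "rigid 0 s = True"
| "rigid (Suc _) 0 = True"
| "rigid (Suc _) (Suc _) = False"

lemma rigid_iff: "rigid s s' \<longleftrightarrow> s = 0 \<or> s' = 0" by (cases s; cases s') auto

fun onto :: "cell list \<Rightarrow> cell list \<Rightarrow> cell list" where
  "onto [] ys = ys"
| "onto (x # xs) ys = onto xs (x # ys)"

lemma onto: "onto xs ys = rev xs @ ys" by (induction xs ys rule: onto.induct) auto

definition sift1 where
  "sift1 b n s i h n' s' i' h' cs X Y Z = (if b then sift (Cell n s i h) cs X Y (Cell n' s' i' h' # Z)
      else if s = 0 \<or> s' = 0 then sift (Cell n s i h) cs (Cell n' s' i' h' # X) Y Z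
      else sift (Cell n s i h) cs X (Cell n' s' i' h' # Y) Z)"

definition sift2 where "sift2 b c d cs X Y Z = (if b then sift c cs (d # X) Y Z
  else sift c cs X (d # Y) Z)"

lemma [code]:
  "sift c [] X Y Z = onto X (onto Y (onto Z []))"
  "sift (Cell n s i h) (Cell n' s' i' h' # cs) X Y Z =
      sift1 (linked i h i' h') n s i h n' s' i' h' cs X Y Z"
  by (simp_all add: sift1_def onto)

lemma [code]:
  "sift1 True n s i h n' s' i' h' cs X Y Z = sift (Cell n s i h) cs X Y (Cell n' s' i' h' # Z)"
  "sift1 False n s i h n' s' i' h' cs X Y Z =
      sift2 (rigid s s') (Cell n s i h) (Cell n' s' i' h') cs X Y Z"
  by (simp_all add: sift1_def sift2_def rigid_iff)

lemma [code]:
  "sift2 True c d cs X Y Z = sift c cs (d # X) Y Z"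
  "sift2 False c d cs X Y Z = sift c cs X (d # Y) Z"
  by (simp_all add: sift2_def)

definition ins1 where "ins1 b c d cs = (if b then d # insert_cell c cs else c # d # cs)"

lemma [code]:
  "ins1 True c d cs = d # insert_cell c cs"
  "ins1 False c d cs = c # d # cs"
  by (simp_all add: ins1_def)

lemma [code]:
  "insert_cell c [] = [c]"
  "insert_cell (Cell n s i h) (Cell n' s' i' h' # cs) =
      ins1 (lt s' s) (Cell n s i h) (Cell n' s' i' h') cs"
  by (simp_all add: ins1_def lt_iff)

fun sortc :: "cell list \<Rightarrow> cell list" where
  "sortc [] = []"
| "sortc (c # cs) = insert_cell c (sortc cs)"

lemma sortc: "sortc cs = foldr insert_cell cs []" by (induction cs) auto

lemma [code]:
  "arrange cs = chain cs (sortc cs)" by (simp add: arrange_def sortc)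

lemma [code]:
  "less1 (Cell 0 s i h) cs = cs"
  "less1 (Cell (Suc 0) s i h) cs = cs"
  "less1 (Cell (Suc (Suc n)) s i h) cs = Cell (Suc n) s i h # cs"
  by simp_all

lemma [code]:
  "count_I [] = 0"
  "count_I (Cell n s True h # cs) = n + count_I cs"
  "count_I (Cell n s False h # cs) = count_I cs"
  by simp_all

lemma [code]:
  "small r (Cell n s True h) u = lt (trio_concentration u) r"
  "small r (Cell n s False h) u = False"
  by (simp_all add: lt_iff)

definition fits1 where "fits1 b i h cs = (b \<and> fits i h cs)"

lemma [code]:
  "fits1 True i h cs = fits i h cs"
  "fits1 False i h cs = False"
  by (simp_all add: fits1_def)

lemma [code]:
  "fits i h [] = True"
  "fits i h (Cell n s i' h' # cs) = fits1 (linked i h i' h') i h cs"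
  by (simp_all add: fits1_def)

definition selfok :: "nat \<Rightarrow> bool \<Rightarrow> colour list \<Rightarrow> bool" where
  "selfok n i h = (n = 1 \<or> linked i h i h)"

lemma [code]:
  "selfok 0 i h = linked i h i h"
  "selfok (Suc 0) i h = True"
  "selfok (Suc (Suc n)) i h = linked i h i h"
  by (simp_all add: selfok_def)

definition tc0 where
  "tc0 b c i h cs X Y Z = (b \<and> (fits i h X \<and> tricol cs (c # X) Y Z \<or>
     X \<noteq> [] \<and> (fits i h Y \<and> tricol cs X (c # Y) Z \<or> Y \<noteq> [] \<and> fits i h Z \<and> tricol cs X Y (c # Z))))"

definition tc1 where
  "tc1 b c i h cs X Y Z = (b \<and> tricol cs (c # X) Y Z \<or>
     X \<noteq> [] \<and> (fits i h Y \<and> tricol cs X (c # Y) Z \<or> Y \<noteq> [] \<and> fits i h Z \<and> tricol cs X Y (c # Z)))"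

definition tc2 where
  "tc2 b c i h cs X Y Z = (b \<or>
     X \<noteq> [] \<and> (fits i h Y \<and> tricol cs X (c # Y) Z \<or> Y \<noteq> [] \<and> fits i h Z \<and> tricol cs X Y (c # Z)))"

definition tc3 where
  "tc3 b c i h cs X Y Z = (b \<and> tricol cs X (c # Y) Z \<or> Y \<noteq> [] \<and> fits i h Z \<and> tricol cs X Y (c # Z))"

definition tc4 where
  "tc4 b c i h cs X Y Z = (b \<or> Y \<noteq> [] \<and> fits i h Z \<and> tricol cs X Y (c # Z))"

definition tc5 where "tc5 b c cs X Y Z = (b \<and> tricol cs X Y (c # Z))"

lemma [code]:
  "tricol [] X Y Z = True"
  "tricol (Cell n s i h # cs) X Y Z = tc0 (selfok n i h) (Cell n s i h) i h cs X Y Z"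
  by (simp_all add: tc0_def selfok_def)

lemma [code]:
  "tc0 True c i h cs X Y Z = tc1 (fits i h X) c i h cs X Y Z"
  "tc0 False c i h cs X Y Z = False"
  by (simp_all add: tc0_def tc1_def)

lemma [code]:
  "tc1 True c i h cs X Y Z = tc2 (tricol cs (c # X) Y Z) c i h cs X Y Z"
  "tc1 False c i h cs X Y Z = tc2 False c i h cs X Y Z"
  by (simp_all add: tc1_def tc2_def)

lemma [code]:
  "tc2 True c i h cs X Y Z = True"
  "tc2 False c i h cs [] Y Z = False"
  "tc2 False c i h cs (x # X) Y Z = tc3 (fits i h Y) c i h cs (x # X) Y Z"
  by (simp_all add: tc2_def tc3_def)

lemma [code]:
  "tc3 True c i h cs X Y Z = tc4 (tricol cs X (c # Y) Z) c i h cs X Y Z"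
  "tc3 False c i h cs X Y Z = tc4 False c i h cs X Y Z"
  by (simp_all add: tc3_def tc4_def)

lemma [code]:
  "tc4 True c i h cs X Y Z = True"
  "tc4 False c i h cs X [] Z = False"
  "tc4 False c i h cs X (y # Y) Z = tc5 (fits i h Z) c cs X (y # Y) Z"
  by (simp_all add: tc4_def tc5_def)

lemma [code]:
  "tc5 True c cs X Y Z = tricol cs X Y (c # Z)"
  "tc5 False c cs X Y Z = False"
  by (simp_all add: tc5_def)

definition
  "pl1 x y z s i h b c X Y Z u v =
    (case u of None \<Rightarrow> None | Some a \<Rightarrow>
     (case v of None \<Rightarrow> None | Some X \<Rightarrow>
     if y \<le> b \<and> z \<le> c then
     (case (add y s i h Y, add z s i h Z) of (Some Y', Some Z') \<Rightarrow>
         Some (Trio a (b - y) (c - z) X Y' Z') | _ \<Rightarrow> None) else None))"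

definition
  "pl2 z s i h a X c Z u v =
    (case u of None \<Rightarrow> None | Some b \<Rightarrow>
     (case v of None \<Rightarrow> None | Some Y \<Rightarrow>
     if z \<le> c then (case add z s i h Z of Some Z' \<Rightarrow> Some (Trio a b (c - z) X Y Z') | _ \<Rightarrow> None)
         else None))"

definition
  "pl3 a b X Y u v =
    (case u of None \<Rightarrow> None | Some c \<Rightarrow> (case v of None \<Rightarrow> None | Some Z \<Rightarrow> Some (Trio a b c X Y Z)))"

lemma [code]:
  "place (x, y, z) s i h (Trio a b c X Y Z) = pl1 x y z s i h b c X Y Z (sub a x) (add x s i h X)"
  by (auto simp: place_def pl1_def sub_eq split: option.split)

lemma [code]:
  "pl1 x y z s i h b c X Y Z None v = None"
  "pl1 x y z s i h b c X Y Z (Some a) None = None"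
  "pl1 x y z s i h b c X Y Z (Some a) (Some X') = pl2 z s i h a X' c Z (sub b y) (add y s i h Y)"
  by (auto simp: pl1_def pl2_def sub_eq split: option.split)

lemma [code]:
  "pl2 z s i h a X c Z None v = None"
  "pl2 z s i h a X c Z (Some b) None = None"
  "pl2 z s i h a X c Z (Some b) (Some Y) = pl3 a b X Y (sub c z) (add z s i h Z)"
  by (auto simp: pl2_def pl3_def sub_eq split: option.split)

lemma [code]:
  "pl3 a b X Y None v = None"
  "pl3 a b X Y (Some c) None = None"
  "pl3 a b X Y (Some c) (Some Z) = Some (Trio a b c X Y Z)"
  by (simp_all add: pl3_def)

fun ord1 :: "nat \<Rightarrow> nat \<times> nat \<times> nat \<Rightarrow> bool" where
  "ord1 0 (x,y,z) = conj2 (\<not> lt x y) (\<not> lt y z)"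
| "ord1 (Suc 0) (x,y,z) = (\<not> lt y z)"
| "ord1 (Suc (Suc m)) t = True"

lemma [code]:
  "ordered m t = ord1 m t"
  by (cases "(m, t)" rule: ord1.cases) (auto simp: ordered_def lt_iff conj2_def)

fun op1 :: "nat \<Rightarrow> nat \<times> nat \<times> nat \<Rightarrow> nat" where
  "op1 m (x, y, Suc z) = Suc (Suc (Suc 0))"
| "op1 0 (x, Suc y, 0) = Suc (Suc 0)"
| "op1 (Suc 0) (x, Suc y, 0) = Suc (Suc 0)"
| "op1 (Suc (Suc m)) (x, Suc y, 0) = Suc (Suc m)"
| "op1 0 (x,0,0) = Suc 0"
| "op1 (Suc m) (x,0,0) = Suc m"

lemma [code]:
  "opened m t = op1 m t"
  by (cases "(m, t)" rule: op1.cases) (auto simp: opened_def max_def)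

definition
  "tr1 b f al r Ls c m cs s i h u t ts =
      ((b \<longrightarrow> goodo f al r Ls c (opened m t) cs (place t s i h u)) \<and> tries f al r Ls c m cs s i h u ts)"

definition "tr2 b f al r Ls c m cs s i h u ts = (b \<and> tries f al r Ls c m cs s i h u ts)"

lemma [code]:
  "tr2 True f al r Ls c m cs s i h u ts = tries f al r Ls c m cs s i h u ts"
  "tr2 False f al r Ls c m cs s i h u ts = False"
  by (simp_all add: tr2_def)

lemma [code]:
  "tr1 False f al r Ls c m cs s i h u t ts = tries f al r Ls c m cs s i h u ts"
  "tr1 True f al r Ls c m cs s i h u t ts =
      tr2 (goodo f al r Ls c (opened m t) cs (place t s i h u)) f al r Ls c m cs s i h u ts"
  by (simp_all add: tr1_def tr2_def)

lemma [code]: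
  "tries f al r Ls c m cs s i h u [] = True"
  "tries f al r Ls c m cs s i h u (t # ts) = tr1 (ordered m t) f al r Ls c m cs s i h u t ts"
  by (simp_all add: tries_def tr1_def)

definition
  "putR o1 a b c Y Z = (case o1 of None \<Rightarrow> None | Some X \<Rightarrow> Some (Trio a b c X Y Z))"

definition
  "putG o1 a b c X Z = (case o1 of None \<Rightarrow> None | Some Y \<Rightarrow> Some (Trio a b c X Y Z))"

definition
  "putB o1 a b c X Y = (case o1 of None \<Rightarrow> None | Some Z \<Rightarrow> Some (Trio a b c X Y Z))"

lemma [code]:
  "putR None a b c Y Z = None"
  "putR (Some X) a b c Y Z = Some (Trio a b c X Y Z)"
  by (simp_all add: putR_def)

lemma [code]:
  "putG None a b c X Z = None"
  "putG (Some Y) a b c X Z = Some (Trio a b c X Y Z)"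
  by (simp_all add: putG_def)

lemma [code]:
  "putB None a b c X Y = None"
  "putB (Some Z) a b c X Y = Some (Trio a b c X Y Z)"
  by (simp_all add: putB_def)

text \<open>Most cells are single vertices. For these the enumeration of triples is replaced by the at most
  three choices of a colour.\<close>

definition "plR s i h u = place (1,0,0) s i h u"

definition "plG s i h u = place (0,1,0) s i h u"

definition "plB s i h u = place (0,0,1) s i h u"

lemma [code]:
  "plR s i h (Trio 0 b c X Y Z) = None"
  "plR s i h (Trio (Suc a) b c X Y Z) = putR (put (Suc 0) s i h [] X) a b c Y Z"
  by (auto simp: plR_def place_def putR_def add_def split: option.split)

lemma [code]:
  "plG s i h (Trio a 0 c X Y Z) = None"
  "plG s i h (Trio a (Suc b) c X Y Z) = putG (put (Suc 0) s i h [] Y) a b c X Z"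
  by (auto simp: plG_def place_def putG_def add_def split: option.split)

lemma [code]:
  "plB s i h (Trio a b 0 X Y Z) = None"
  "plB s i h (Trio a b (Suc c) X Y Z) = putB (put (Suc 0) s i h [] Z) a b c X Y"
  by (auto simp: plB_def place_def putB_def add_def split: option.split)

lemma [code]:
  "goodo f al r Ls c m cs None = True"
  "goodo f al r Ls c m cs (Some u) = goodp f al r Ls c m cs u"
  by (simp_all add: goodo_def)

definition "one m f al r Ls c cs s i h u = tries f al r Ls c m cs s i h u (splits (Suc 0))"

definition "oneG b m f al r Ls c cs s i h u = (b \<and> goodo f al r Ls c m cs (plG s i h u))"

definition
  "oneGB b m f al r Ls c cs s i h u = (b \<and> goodo f al r Ls c m cs (plG s i h u) \<and>
      goodo f al r Ls c 3 cs (plB s i h u))"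

definition "oneB b f al r Ls c cs s i h u = (b \<and> goodo f al r Ls c 3 cs (plB s i h u))"

lemma [code]:
  "oneG True m f al r Ls c cs s i h u = goodo f al r Ls c m cs (plG s i h u)"
  "oneG False m f al r Ls c cs s i h u = False"
  by (simp_all add: oneG_def)

lemma [code]:
  "oneB True f al r Ls c cs s i h u = goodo f al r Ls c (Suc (Suc (Suc 0))) cs (plB s i h u)"
  "oneB False f al r Ls c cs s i h u = False"
  by (simp_all add: oneB_def numeral_3_eq_3)

lemma [code]:
  "oneGB True m f al r Ls c cs s i h u =
      oneB (goodo f al r Ls c m cs (plG s i h u)) f al r Ls c cs s i h u"
  "oneGB False m f al r Ls c cs s i h u = False"
  by (simp_all add: oneB_def oneGB_def)

lemma splits1: "splits (Suc 0) = [(0,0,1),(0,1,0),(1,0,0)]" by (simp add: splits_def)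

lemma [code]:
  "one 0 f al r Ls c cs s i h u = goodo f al r Ls c (Suc 0) cs (plR s i h u)"
  "one (Suc 0) f al r Ls c cs s i h u = oneG (goodo f al r Ls c (Suc 0) cs (plR s i h u)) (Suc (Suc 0))
      f al r Ls c cs s i h u"
  "one (Suc (Suc m)) f al r Ls c cs s i h u =
      oneGB (goodo f al r Ls c (Suc (Suc m)) cs (plR s i h u)) (Suc (Suc m)) f al r Ls c cs s i h u"
  by (auto simp: one_def splits1 tries_def ordered_def opened_def plR_def plG_def plB_def oneG_def
    oneGB_def max_def numeral_2_eq_2)

lemma [code]:
  "goodp f al r Ls c m [] u = good f al r Ls c u"
  "goodp f al r Ls c m (Cell (Suc 0) s i h # cs) u = one m f al r Ls c cs s i h u"
  "goodp f al r Ls c m (Cell 0 s i h # cs) u = tries f al r Ls c m cs s i h u (splits 0)"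
  "goodp f al r Ls c m (Cell (Suc (Suc n)) s i h # cs) u =
      tries f al r Ls c m cs s i h u (splits (Suc (Suc n)))"
  by (simp_all only: goodp_Nil goodp_Cons one_def)

definition "good1 b f al r Ls cs = (b \<or> refuted f al r Ls cs)"

lemma [code]:
  "good1 True f al r Ls cs = True"
  "good1 False f al r Ls cs = refuted f al r Ls cs"
  by (simp_all add: good1_def)

lemma [code]:
  "good f al r Ls c u = good1 (small r c u) f al r Ls (record_colouring c u)"
  by (simp add: good_def good1_def)

definition "cl1 b f al r Ls cs = (b \<or> (case pick None [] cs of None \<Rightarrow> cs \<in> set Ls
     | Some (c, cs') \<Rightarrow> list_all (\<lambda>u. small r c u \<or> refuted f al r Ls (record_colouring c u))
         (extensions al c cs')))"

definition "cl2 q f al r Ls cs = (case q of None \<Rightarrow> cs \<in> set Ls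
     | Some (c, cs') \<Rightarrow> list_all (\<lambda>u. small r c u \<or> refuted f al r Ls (record_colouring c u))
         (extensions al c cs'))"

lemma [code]:
  "refuted 0 al r Ls cs = (cs \<in> set Ls)"
  "refuted (Suc f) al r Ls cs = cl1 (tricol cs [] [] []) f al r Ls cs"
  by (simp_all add: cl1_def)

lemma [code]:
  "cl1 True f al r Ls cs = True"
  "cl1 False f al r Ls cs = cl2 (pick None [] cs) f al r Ls cs"
  by (simp_all add: cl1_def cl2_def)

lemma [code]:
  "cl2 None f al r Ls cs = (cs \<in> set Ls)"
  "cl2 (Some (c, cs')) f al r Ls cs = goodp f al r Ls c 0 (arrange (less1 c cs')) (Trio al al al [] []
      [])"
  by (auto simp: cl2_def goodp_def extensions_def good_def list_all_iff)

section \<open>What a search state says about a graph\<close>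

fun key_of :: "cell \<Rightarrow> bool \<times> colour list" where "key_of (Cell n s i h) = (i, h)"

fun size_of :: "cell \<Rightarrow> nat" where "size_of (Cell n s i h) = n"

fun slack_of :: "cell \<Rightarrow> nat" where "slack_of (Cell n s i h) = s"

definition linked_keys :: "bool \<times> colour list \<Rightarrow> bool \<times> colour list \<Rightarrow> bool" where
  "linked_keys p q = linked (fst p) (snd p) (fst q) (snd q)"

text \<open>The colours in use are always the first ones of the list.\<close>

lemma in_take3:
  assumes "x \<noteq> Blank" "x = Red \<longrightarrow> 1 \<le> m" "x = Green \<longrightarrow> 2 \<le> m" "x = Blue \<longrightarrow> 3 \<le> m"
  shows "x \<in> set (take m [Red, Green, Blue])"
proof -
  have "m = 0 \<or> m = Suc 0 \<or> m = Suc (Suc 0) \<or> (\<exists>k. m = Suc (Suc (Suc k)))" by presburger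
  then show ?thesis using assms by (cases x) auto
qed

lemma agree_map: "agree (map f cs) (map g cs) \<longleftrightarrow> (\<exists>c\<in>set cs. f c = g c \<and> f c \<noteq> Blank)"
proof (induction cs)
  case (Cons c cs) then show ?case by (cases "f c"; cases "g c") auto
qed simp

lemma agree_sym: "agree h h' = agree h' h"
  by (induction h h' rule: agree.induct) auto

lemma linked_keys_sym: "linked_keys p q = linked_keys q p"
  by (cases p; cases q; cases "fst p"; cases "fst q") (auto simp: linked_keys_def agree_sym)

text \<open>Only the multiset of resulting cells matters; \<open>put\<close> reverses their order.\<close>

lemma put_mset:
  assumes "(\<Sum>p\<leftarrow>filter (\<lambda>p. \<not> linked_keys (i, h) (key_of p)) cs. size_of p) \<le> s"
    and "\<And>p. p \<in> set cs \<Longrightarrow> \<not> linked_keys (i, h) (key_of p) \<Longrightarrow> a \<le> slack_of p"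
  shows "\<exists>res. put a s i h acc cs = Some res \<and>
     mset res = add_mset (Cell a (s - (\<Sum>p\<leftarrow>filter (\<lambda>p. \<not> linked_keys (i, h) (key_of p)) cs. size_of p)) i
         h)
       (image_mset (\<lambda>p. if linked_keys (i, h) (key_of p) then p
           else Cell (size_of p) (slack_of p - a) (fst (key_of p)) (snd (key_of p))) (mset cs) +
           mset acc)"
  using assms
proof (induction a s i h acc cs rule: put.induct)
  case (1 a s i h acc) then show ?case by simp
next
  case (2 a s i h acc a' s' i' h' cs)
  show ?case
  proof (cases "linked i h i' h'")
    case True
    then have "linked_keys (i,h) (i',h')" by (simp add: linked_keys_def)
    then show ?thesis using 2(1)[OF True] 2(3-) True by simp
  next
    case False
    then have l: "\<not> linked_keys (i,h) (i',h')" by (simp add: linked_keys_def)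
    have le: "a' \<le> s" "a \<le> s'" using 2(3) 2(4)[of "Cell a' s' i' h'"] l by auto
    then have "\<exists>res. put a (s - a') i h (Cell a' (s' - a) i' h' # acc) cs = Some res \<and>
      mset res = add_mset (Cell a (s - a' -
          (\<Sum>p\<leftarrow>filter (\<lambda>p. \<not> linked_keys (i, h) (key_of p)) cs. size_of p)) i h)
       (image_mset (\<lambda>p. if linked_keys (i, h) (key_of p) then p
           else Cell (size_of p) (slack_of p - a) (fst (key_of p)) (snd (key_of p))) (mset cs) +
           mset (Cell a' (s' - a) i' h' # acc))"
      using 2(3,4) l by (intro 2(2)[OF False]) auto
    then show ?thesis using False l le by (auto simp: diff_diff_eq)
  qed
qed

text \<open>\<open>D\<close> is the common number of non-neighbours, and \<open>I\<close> a largest independent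
  set.\<close>

locale critical_config =
  fixes V :: "'a set" and adj :: "'a \<Rightarrow> 'a \<Rightarrow> bool" and I :: "'a set" and D al :: nat
  assumes finV: "finite V"
    and adj_sym: "adj u v \<Longrightarrow> adj v u"
    and deg: "v \<in> V \<Longrightarrow> card {u\<in>V. u \<noteq> v \<and> \<not> adj u v} = D"
    and IV: "I \<subseteq> V" and cardI: "card I = al"
    and indI: "u \<in> I \<Longrightarrow> v \<in> I \<Longrightarrow> \<not> adj u v"
    and alpha: "S \<subseteq> V \<Longrightarrow> (\<And>u v. u \<in> S \<Longrightarrow> v \<in> S \<Longrightarrow> u \<noteq> v \<Longrightarrow> \<not> adj u v) \<Longrightarrow> card S \<le> al"
begin

text \<open>The three colours are independent; \<open>Blank\<close> vertices are uncoloured and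
  unconstrained.\<close>

definition partial :: "('a \<Rightarrow> colour) \<Rightarrow> bool" where
  "partial c \<longleftrightarrow> (\<forall>u\<in>V. \<forall>v\<in>V. u \<noteq> v \<longrightarrow> c u = c v \<longrightarrow> c u \<noteq> Blank \<longrightarrow> \<not> adj u v)"

definition punctured :: "'a \<Rightarrow> ('a \<Rightarrow> colour) \<Rightarrow> bool" where
  "punctured w c \<longleftrightarrow> partial c \<and> c w = Blank \<and> (\<forall>v\<in>V. v \<noteq> w \<longrightarrow> c v \<noteq> Blank)"

definition key :: "('a \<Rightarrow> colour) list \<Rightarrow> 'a \<Rightarrow> bool \<times> colour list" where
  "key cs v = (v \<in> I, map (\<lambda>c. c v) cs)"

definition known :: "('a \<Rightarrow> colour) list \<Rightarrow> 'a \<Rightarrow> 'a set" where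
  "known cs v = {u\<in>V. u \<noteq> v \<and> linked_keys (key cs u) (key cs v)}"

text \<open>The state \<open>st\<close> describes the graph together with the colourings \<open>cs\<close>: each
  cell is a class of vertices with equal keys, and slack and known non-neighbours add up to
  \<open>D\<close>.\<close>

definition represents :: "('a \<Rightarrow> colour) list \<Rightarrow> cell list \<Rightarrow> bool" where
  "represents cs st \<longleftrightarrow> (\<forall>c\<in>set cs. partial c) \<and> distinct (map key_of st) \<and> key_of ` set st = key cs ` V \<and>
     (\<forall>p\<in>set st. size_of p = card {v\<in>V. key cs v = key_of p} \<and>
         (\<forall>v\<in>V. key cs v = key_of p \<longrightarrow> slack_of p + card (known cs v) = D))"

lemma linked_keys_iff: "linked_keys (key cs u) (key cs v) \<longleftrightarrow> (u \<in> I \<and> v \<in> I) \<or>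
  (\<exists>c\<in>set cs. c u = c v \<and> c u \<noteq> Blank)"
  by (cases "u \<in> I"; cases "v \<in> I") (auto simp: linked_keys_def key_def agree_map)

lemma linked_nonadj:
  assumes "\<forall>c\<in>set cs. partial c" "u \<in> V" "v \<in> V" "u \<noteq> v" "linked_keys (key cs u) (key cs v)"
  shows "\<not> adj u v"
  using assms indI by (auto simp: linked_keys_iff partial_def)

text \<open>The search enumerates colourings up to the names of the three colours.\<close>

definition recoloured :: "('a \<Rightarrow> colour) \<Rightarrow> ('a \<Rightarrow> colour) \<Rightarrow> bool" where
  "recoloured c c' \<longleftrightarrow> (\<exists>p. inj p \<and> p Blank = Blank \<and> c' = p \<circ> c)"

lemma recoloured_refl: "recoloured c c" unfolding recoloured_def by (rule exI[of _ id]) auto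

lemma recoloured_trans: "recoloured c d \<Longrightarrow> recoloured d e \<Longrightarrow> recoloured c e"
  unfolding recoloured_def by (metis comp_assoc comp_apply inj_compose)

lemma recoloured_swap: "x \<noteq> Blank \<Longrightarrow> y \<noteq> Blank \<Longrightarrow> recoloured c (\<lambda>v. if c v = x then y else if c v = y
  then x else c v)"
  unfolding recoloured_def
  by (rule exI[of _ "\<lambda>z. if z = x then y else if z = y then x else z"]) (auto simp: inj_def)

lemma recoloured_punctured:
  assumes "recoloured c c'" "punctured w c" shows "punctured w c'"
proof -
  obtain p where p: "inj p" "p Blank = Blank" "c' = p \<circ> c" using assms by (auto simp: recoloured_def)
  have "p x = Blank \<longleftrightarrow> x = Blank" for x using p by (metis injD)
  moreover have "p x = p y \<longleftrightarrow> x = y" for x y using p by (metis injD)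
  ultimately show ?thesis using assms(2) p(3) by (auto simp: punctured_def partial_def)
qed

context
  fixes cs :: "('a \<Rightarrow> colour) list" and w :: 'a
  assumes pcs: "\<forall>c\<in>set cs. partial c" and wV: "w \<in> V"
begin

definition part :: "(bool \<times> colour list) \<Rightarrow> colour \<Rightarrow> ('a \<Rightarrow> colour) \<Rightarrow> 'a set" where
  "part k col c = {v\<in>V - {w}. key cs v = k \<and> c v = col}"

text \<open>The non-neighbours of \<open>v\<close> known while \<open>c\<close> is being enumerated: it has
  already been revealed on the vertices whose key lies in \<open>K\<close>.\<close>

definition known_with :: "('a \<Rightarrow> colour) \<Rightarrow> (bool \<times> colour list) set \<Rightarrow> 'a \<Rightarrow> 'a set" where
  "known_with c K v = {u\<in>V. u \<noteq> v \<and> (linked_keys (key cs u) (key cs v) \<or>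
      (u \<noteq> w \<and> key cs u \<in> K \<and> c u = c v))}"

text \<open>The invariant of one list in a \<open>trio\<close>: it lists the parts of the cells with key in
  \<open>K\<close> in the colour class \<open>col\<close>, with their slack when everything known so far is
  counted.\<close>

definition class_cells :: "('a \<Rightarrow> colour) \<Rightarrow> (bool \<times> colour list) set \<Rightarrow> colour \<Rightarrow> cell list \<Rightarrow> bool" where
  "class_cells c K col X \<longleftrightarrow> distinct (map key_of X) \<and> key_of ` set X = {k\<in>K. part k col c \<noteq> {}} \<and>
     (\<forall>p\<in>set X. size_of p = card (part (key_of p) col c) \<and>
         (\<forall>v\<in>part (key_of p) col c. slack_of p + card (known_with c K v) = D))"

lemma known_with_nonadj:
  assumes "punctured w c" "v \<in> V" "v \<noteq> w"
  shows "known_with c K v \<subseteq> {u\<in>V. u \<noteq> v \<and> \<not> adj u v}"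
  using assms pcs linked_nonadj unfolding known_with_def punctured_def partial_def by blast

lemma card_known_with_le: "punctured w c \<Longrightarrow> v \<in> V \<Longrightarrow> v \<noteq> w \<Longrightarrow> card (known_with c K v) \<le> D"
  using card_mono[OF _ known_with_nonadj] deg finV by fastforce

lemma finite_part: "finite (part k col c)" unfolding part_def using finV by auto

lemma sum_cells:
  assumes "distinct (map key_of X)" "\<forall>p\<in>set X. size_of p = card (part (key_of p) col c)"
  shows "(\<Sum>p\<leftarrow>filter Q X. size_of p) = card (\<Union>p\<in>set (filter Q X). part (key_of p) col c)"
  using assms
proof (induction X)
  case (Cons p X)
  have "part (key_of p) col c \<inter> (\<Union>p\<in>set (filter Q X). part (key_of p) col c) = {}"
  proof -
    have "key_of q \<noteq> key_of p" if "q \<in> set X" for q using Cons.prems(1) imageI[OF that, of key_of]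
      by auto
    then show ?thesis by (auto simp: part_def)
  qed
  then have "card (part (key_of p) col c \<union> (\<Union>p\<in>set (filter Q X). part (key_of p) col c)) =
    card (part (key_of p) col c) + card (\<Union>p\<in>set (filter Q X). part (key_of p) col c)"
    by (intro card_Un_disjoint) (auto simp: finite_part)
  then show ?case using Cons by auto
qed simp

text \<open>The cells of the class that are not linked to the new part are new non-neighbours of its vertices,
  disjoint from those known before. Hence sizes add up, and since all vertices involved are true non-neighbours,
  no slack can become negative: \<open>put\<close> fails only for colourings that do not exist.\<close>

lemma put_correct:
  assumes c: "punctured w c" and X: "class_cells c K col X" and col: "col \<noteq> Blank"
    and k: "(i, h) \<notin> K" and ne: "part (i, h) col c \<noteq> {}"
    and s: "\<And>v. v \<in> part (i, h) col c \<Longrightarrow>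
       s + card ({u\<in>V. u \<noteq> v \<and> linked_keys (key cs u) (key cs v)} \<union> (part (i, h) col c - {v})) = D"
  shows "\<exists>X'. put (card (part (i, h) col c)) s i h [] X = Some X' \<and>
      class_cells c (insert (i, h) K) col X'"
proof -
  let ?k = "(i, h)" let ?Q = "part ?k col c" let ?a = "card ?Q" let ?K' = "insert ?k K"
  let ?f = "\<lambda>p. if linked_keys ?k (key_of p) then p
    else Cell (size_of p) (slack_of p - ?a) (fst (key_of p)) (snd (key_of p))"
  let ?T = "\<Sum>p\<leftarrow>filter (\<lambda>p. \<not> linked_keys ?k (key_of p)) X. size_of p"
  let ?U = "\<Union>p\<in>set (filter (\<lambda>p. \<not> linked_keys ?k (key_of p)) X). part (key_of p) col c"
  have dX: "distinct (map key_of X)" and kX: "key_of ` set X = {k\<in>K. part k col c \<noteq> {}}"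
    and nX: "\<forall>p\<in>set X. size_of p = card (part (key_of p) col c)"
    and sX: "\<And>p v. p \<in> set X \<Longrightarrow> v \<in> part (key_of p) col c \<Longrightarrow> slack_of p + card (known_with c K v) = D"
    using X by (auto simp: class_cells_def)
  have T: "?T = card ?U" using sum_cells[OF dX nX] .
  \<comment> \<open>These are the vertices that become known as non-neighbours of the new part.\<close>
  have U: "?U = {u\<in>V - {w}. key cs u \<in> K \<and> c u = col \<and> \<not> linked_keys ?k (key cs u)}"
  proof -
    have "u \<in> ?U" if "u \<in> V - {w}" "key cs u \<in> K" "c u = col" "\<not> linked_keys ?k (key cs u)" for u
    proof -
      have "u \<in> part (key cs u) col c" using that by (auto simp: part_def)
      then have "key cs u \<in> key_of ` set X" using kX that by auto
      then obtain p where "p \<in> set X" "key_of p = key cs u" by (metis imageE)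
      then show ?thesis using \<open>u \<in> part (key cs u) col c\<close> that by auto
    qed
    then show ?thesis using kX by (auto simp: part_def)
  qed
  have new: "s = ?T + (D - card (known_with c ?K' v)) \<and> card (known_with c ?K' v) \<le> D" if v: "v \<in> ?Q"
    for v
  proof -
    have vV: "v \<in> V" "v \<noteq> w" "key cs v = ?k" "c v = col" using v by (auto simp: part_def)
    let ?B = "{u\<in>V. u \<noteq> v \<and> linked_keys (key cs u) (key cs v)} \<union> (?Q - {v})"
    have e: "known_with c ?K' v = ?B \<union> ?U"
      unfolding U using vV k by (auto simp: known_with_def part_def linked_keys_sym)
    have "?B \<inter> ?U = {}" unfolding U using vV k by (auto simp: part_def linked_keys_sym)
    then have "card (known_with c ?K' v) = card ?B + ?T"
      unfolding e T by (intro card_Un_disjoint) (auto simp: finV finite_part)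
    moreover have "card (known_with c ?K' v) \<le> D" using card_known_with_le[OF c] vV by auto
    ultimately show ?thesis using s[OF v] by auto
  qed
  have old: "slack_of p = (if linked_keys ?k (key_of p) then 0 else ?a) +
    (D - card (known_with c ?K' v)) \<and> card (known_with c ?K' v) \<le> D"
    if p: "p \<in> set X" and v: "v \<in> part (key_of p) col c" for p v
  proof -
    have vV: "v \<in> V" "v \<noteq> w" "key cs v = key_of p" "c v = col" using v by (auto simp: part_def)
    have pK: "key_of p \<in> K" using kX p by auto
    have le: "card (known_with c ?K' v) \<le> D" using card_known_with_le[OF c] vV by auto
    show ?thesis
    proof (cases "linked_keys ?k (key_of p)")
      case True
      then have "known_with c ?K' v = known_with c K v" using vV by (auto simp: known_with_def)
      then show ?thesis using sX[OF p v] le True by auto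
    next
      case False
      have e: "known_with c ?K' v = known_with c K v \<union> ?Q" using vV False pK k
        by (auto simp: known_with_def part_def)
      have "known_with c K v \<inter> ?Q = {}" using vV False k by (auto simp: known_with_def part_def)
      then have "card (known_with c ?K' v) = card (known_with c K v) + ?a"
        unfolding e by (intro card_Un_disjoint) (auto simp: known_with_def finV finite_part)
      then show ?thesis using sX[OF p v] le False by auto
    qed
  qed
  have neX: "part (key_of p) col c \<noteq> {}" if "p \<in> set X" for p using kX that by auto
  obtain v0 where "v0 \<in> ?Q" using ne by auto
  then have 1: "?T \<le> s" using new by force
  have 2: "?a \<le> slack_of p" if p: "p \<in> set X" "\<not> linked_keys ?k (key_of p)" for p
  proof -
    obtain v where "v \<in> part (key_of p) col c" using neX[OF p(1)] by blast
    then show ?thesis using old[of p v] p by auto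
  qed
  from put_mset[OF 1 2, of "[]"] obtain X' where X': "put ?a s i h [] X = Some X'"
    and m: "mset X' = add_mset (Cell ?a (s - ?T) i h) (image_mset ?f (mset X))" by auto
  have kf: "key_of (?f p) = key_of p" for p by (cases p) auto
  have nf: "size_of (?f p) = size_of p" for p by (cases p) auto
  have sf: "slack_of (?f p) = slack_of p - (if linked_keys ?k (key_of p) then 0 else ?a)" for p
    by (cases p) auto
  have set': "set X' = insert (Cell ?a (s - ?T) i h) (?f ` set X)"
    using arg_cong[OF m, of set_mset] by simp
  have "mset (map key_of X') = mset (?k # map key_of X)"
    using arg_cong[OF m, of "image_mset key_of"] kf by (simp add: image_mset.compositionality comp_def)
  moreover have "distinct (?k # map key_of X)" using dX kX k by (auto dest: imageI[of _ _ key_of])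
  ultimately have d': "distinct (map key_of X')" by (metis mset_eq_imp_distinct_iff)
  have k': "key_of ` set X' = {k\<in>?K'. part k col c \<noteq> {}}"
  proof -
    have "key_of ` set X' = insert ?k (key_of ` set X)" unfolding set' image_insert image_image kf
      by simp
    also have "\<dots> = {k\<in>?K'. part k col c \<noteq> {}}" unfolding kX using ne by auto
    finally show ?thesis .
  qed
  have "class_cells c ?K' col X'"
    unfolding class_cells_def
  proof (intro conjI ballI)
    fix p assume p: "p \<in> set X'"
    show "size_of p = card (part (key_of p) col c)" using p nX unfolding set' by (auto simp: kf nf)
    fix v assume v: "v \<in> part (key_of p) col c"
    from p consider "p = Cell ?a (s - ?T) i h" | q where "q \<in> set X" "p = ?f q" unfolding set' by auto
    then show "slack_of p + card (known_with c ?K' v) = D"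
    proof cases
      case 1
      then have "v \<in> ?Q" using v by simp
      then show ?thesis using new[of v] 1 by auto
    next
      case 2
      then have "v \<in> part (key_of q) col c" using v kf by auto
      then show ?thesis using old[of q v] 2 sf[of q] by auto
    qed
  qed (use d' k' in auto)
  then show ?thesis using X' by auto
qed

lemma class_cells_empty:
  assumes X: "class_cells c K col X" and e: "part k col c = {}"
  shows "class_cells c (insert k K) col X"
proof -
  have "known_with c (insert k K) v = known_with c K v" if "v \<in> part p col c" for p v
    using that e by (auto simp: known_with_def part_def)
  then show ?thesis using X e unfolding class_cells_def by auto
qed

lemma add_correct:
  assumes c: "punctured w c" and X: "class_cells c K col X" and col: "col \<noteq> Blank"
    and k: "(i, h) \<notin> K"
    and s: "\<And>v. v \<in> V - {w} \<Longrightarrow> key cs v = (i, h) \<Longrightarrow> s + card (known cs v) = D"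
  shows "\<exists>X'. add (card (part (i, h) col c)) s i h X = Some X' \<and> class_cells c (insert (i, h) K) col X'"
proof (cases "part (i, h) col c = {}")
  case True
  then show ?thesis using class_cells_empty[OF X True] by (simp add: add_def)
next
  case False
  let ?Q = "part (i, h) col c"
  have pos: "card ?Q \<noteq> 0" using False finite_part by auto
  have Q: "v \<in> V - {w}" "key cs v = (i, h)" if "v \<in> ?Q" for v using that by (auto simp: part_def)
  show ?thesis
  proof (cases "linked i h i h")
    case True
    then have "linked_keys (i, h) (i, h)" by (simp add: linked_keys_def)
    then have "{u\<in>V. u \<noteq> v \<and> linked_keys (key cs u) (key cs v)} \<union> (?Q - {v}) = known cs v" if "v \<in> ?Q"
      for v
      using Q[OF that] by (auto simp: known_def part_def)
    then show ?thesis
      using put_correct[OF c X col k False, of s] s Q True pos by (simp add: add_def)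
  next
    case F: False
    then have nl: "\<not> linked_keys (i, h) (i, h)" by (simp add: linked_keys_def)
    have e: "card ({u\<in>V. u \<noteq> v \<and> linked_keys (key cs u) (key cs v)} \<union> (?Q - {v})) = card (known cs v) +
      (card ?Q - 1)"
      if "v \<in> ?Q" for v
    proof -
      have "card ({u\<in>V. u \<noteq> v \<and> linked_keys (key cs u) (key cs v)} \<union> (?Q - {v})) = card (known cs v) +
        card (?Q - {v})"
        unfolding known_def using nl Q[OF that]
        by (intro card_Un_disjoint) (auto simp: finV finite_part, auto simp: part_def)
      then show ?thesis using that by simp
    qed
    have le: "card (known cs v) + (card ?Q - 1) \<le> D" if v: "v \<in> ?Q" for v
    proof -
      have "{u\<in>V. u \<noteq> v \<and> linked_keys (key cs u) (key cs v)} \<union> (?Q - {v}) \<subseteq> known_with c {(i, h)} v"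
        using v by (auto simp: known_with_def part_def)
      then have "card (known cs v) + (card ?Q - 1) \<le> card (known_with c {(i, h)} v)"
        unfolding e[OF v, symmetric] by (intro card_mono) (auto simp: known_with_def finV)
      also have "\<dots> \<le> D" using card_known_with_le[OF c] Q[OF v] by auto
      finally show ?thesis .
    qed
    obtain v0 where v0: "v0 \<in> ?Q" using False by auto
    then have les: "card ?Q - 1 \<le> s" using le[OF v0] s Q[OF v0] by fastforce
    have "s - (card ?Q - 1) + card ({u\<in>V. u \<noteq> v \<and> linked_keys (key cs u) (key cs v)} \<union> (?Q - {v})) = D"
      if "v \<in> ?Q" for v
      using e[OF that] s[OF Q[OF that]] les by simp
    then show ?thesis
      using put_correct[OF c X col k False, of "s - (card ?Q - 1)"] F pos les by (simp add: add_def)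
  qed
qed

definition trio_cells :: "('a \<Rightarrow> colour) \<Rightarrow> (bool \<times> colour list) set \<Rightarrow> trio \<Rightarrow> bool" where
  "trio_cells c K u = (case u of Trio a b d X Y Z \<Rightarrow> class_cells c K Red X \<and> class_cells c K Green Y \<and>
      class_cells c K Blue Z \<and>
     a + card {v\<in>V - {w}. key cs v \<in> K \<and> c v = Red} = al \<and>
     b + card {v\<in>V - {w}. key cs v \<in> K \<and> c v = Green} = al \<and>
     d + card {v\<in>V - {w}. key cs v \<in> K \<and> c v = Blue} = al)"

text \<open>A colour class is independent and so has at most \<open>\<bar>I\<bar>\<close> vertices.\<close>

lemma room:
  assumes c: "punctured w c" and col: "col \<noteq> Blank" and k: "k \<notin> K"
    and a: "a + card {v\<in>V - {w}. key cs v \<in> K \<and> c v = col} = al"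
  shows "card (part k col c) \<le> a \<and>
    a - card (part k col c) + card {v\<in>V - {w}. key cs v \<in> insert k K \<and> c v = col} = al"
proof -
  let ?S = "{v\<in>V - {w}. key cs v \<in> insert k K \<and> c v = col}"
  have e: "?S = {v\<in>V - {w}. key cs v \<in> K \<and> c v = col} \<union> part k col c" by (auto simp: part_def)
  have "card ?S = card {v\<in>V - {w}. key cs v \<in> K \<and> c v = col} + card (part k col c)"
    unfolding e by (intro card_Un_disjoint) (use k in \<open>auto simp: finV finite_part,
      auto simp: part_def\<close>)
  moreover have "card ?S \<le> al"
    using c col by (intro alpha) (auto simp: punctured_def partial_def)
  ultimately show ?thesis using a by auto
qed

lemma place_correct:
  assumes c: "punctured w c" and u: "trio_cells c K u" and k: "(i, h) \<notin> K"
    and s: "\<And>v. v \<in> V - {w} \<Longrightarrow> key cs v = (i, h) \<Longrightarrow> s + card (known cs v) = D"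
  shows "\<exists>u'. place (card (part (i, h) Red c), card (part (i, h) Green c), card (part (i, h) Blue c)) s
      i h u = Some u' \<and>
     trio_cells c (insert (i, h) K) u'"
proof -
  obtain a b d X Y Z where U: "u = Trio a b d X Y Z" by (cases u)
  have I: "class_cells c K Red X" "class_cells c K Green Y" "class_cells c K Blue Z" using u U
    by (auto simp: trio_cells_def)
  obtain X' Y' Z' where "add (card (part (i, h) Red c)) s i h X = Some X'"
    "class_cells c (insert (i, h) K) Red X'"
    "add (card (part (i, h) Green c)) s i h Y = Some Y'" "class_cells c (insert (i, h) K) Green Y'"
    "add (card (part (i, h) Blue c)) s i h Z = Some Z'" "class_cells c (insert (i, h) K) Blue Z'"
    using add_correct[OF c I(1) _ k s] add_correct[OF c I(2) _ k s] add_correct[OF c I(3) _ k s]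
    by (metis colour.distinct(1,3,5))
  moreover have R: "a + card {v\<in>V - {w}. key cs v \<in> K \<and> c v = Red} = al"
    "b + card {v\<in>V - {w}. key cs v \<in> K \<and> c v = Green} = al"
    "d + card {v\<in>V - {w}. key cs v \<in> K \<and> c v = Blue} = al" using u U by (auto simp: trio_cells_def)
  note room[OF c _ k R(1)] room[OF c _ k R(2)] room[OF c _ k R(3)]
  ultimately show ?thesis unfolding U by (simp add: place_def trio_cells_def)
qed

text \<open>Exchanging two colours, if necessary, makes the first part at least as large as the second.\<close>

lemma sort2:
  assumes "x \<noteq> Blank" "y \<noteq> Blank" "x \<noteq> y"
  shows "\<exists>c'. recoloured c c' \<and> card (part k y c') \<le> card (part k x c') \<and>
    {card (part k x c'), card (part k y c')} = {card (part k x c), card (part k y c)} \<and>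
    (\<forall>z. z \<noteq> x \<longrightarrow> z \<noteq> y \<longrightarrow> part k z c' = part k z c) \<and> (\<forall>v. c v \<noteq> x \<longrightarrow> c v \<noteq> y \<longrightarrow> c' v = c v)"
proof (cases "card (part k y c) \<le> card (part k x c)")
  case True
  then show ?thesis using recoloured_refl by blast
next
  case False
  let ?c = "\<lambda>v. if c v = x then y else if c v = y then x else c v"
  have "part k x ?c = part k y c" "part k y ?c = part k x c"
    "\<forall>z. z \<noteq> x \<longrightarrow> z \<noteq> y \<longrightarrow> part k z ?c = part k z c"
    using assms by (auto simp: part_def)
  then show ?thesis using False recoloured_swap[OF assms(1,2), of c] by (intro exI[of _ ?c]) auto
qed

text \<open>If \<open>m\<close> colours are in use, the other ones may be permuted without changing what has
  been revealed so far; sorting them by the sizes of the parts of the next cell gives an \<open>ordered\<close>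
  split.\<close>

lemma sort_colours:
  assumes "m \<le> 3" "\<forall>v\<in>V - {w}. key cs v \<in> K \<longrightarrow> c v \<in> set (take m [Red, Green, Blue])"
  shows "\<exists>c'. recoloured c c' \<and> ordered m (card (part k Red c'), card (part k Green c'),
      card (part k Blue c')) \<and>
     (\<forall>v\<in>V - {w}. key cs v \<in> K \<longrightarrow> c' v = c v)"
proof -
  consider "m = 0" | "m = 1" | "2 \<le> m" by linarith
  then show ?thesis
  proof cases
    case 1
    obtain c1 where c1: "recoloured c c1" "card (part k Green c1) \<le> card (part k Red c1)"
      using sort2[of Red Green c k] by auto
    obtain c2 where c2: "recoloured c1 c2" "card (part k Blue c2) \<le> card (part k Green c2)"
      "{card (part k Green c2), card (part k Blue c2)} =
          {card (part k Green c1), card (part k Blue c1)}"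
      "part k Red c2 = part k Red c1"
      using sort2[of Green Blue c1 k] by auto
    obtain c3 where c3: "recoloured c2 c3" "card (part k Green c3) \<le> card (part k Red c3)"
      "{card (part k Red c3), card (part k Green c3)} = {card (part k Red c2), card (part k Green c2)}"
      "part k Blue c3 = part k Blue c2"
      using sort2[of Red Green c2 k] by auto
    have "card (part k Blue c3) \<le> card (part k Green c3)"
      using c1(2) c2(2,3,4) c3(2,3,4) by (auto simp: doubleton_eq_iff)
    then have "ordered m (card (part k Red c3), card (part k Green c3), card (part k Blue c3))"
      using c3(2) by (simp add: ordered_def)
    moreover have "recoloured c c3" using recoloured_trans[OF recoloured_trans[OF c1(1) c2(1)] c3(1)] .
    ultimately show ?thesis using assms(2) 1 by (intro exI[of _ c3]) auto
  next
    case 2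
    obtain c' where "recoloured c c'" "card (part k Blue c') \<le> card (part k Green c')"
      "\<forall>v. c v \<noteq> Green \<longrightarrow> c v \<noteq> Blue \<longrightarrow> c' v = c v"
      using sort2[of Green Blue c k] by auto
    then show ?thesis using assms(2) 2 by (intro exI[of _ c']) (auto simp: ordered_def)
  next
    case 3
    then show ?thesis using recoloured_refl by (intro exI[of _ c]) (auto simp: ordered_def)
  qed
qed

lemma class_cells_cong:
  assumes e: "\<forall>v\<in>V - {w}. key cs v \<in> K \<longrightarrow> c' v = c v" and X: "class_cells c K col X"
  shows "class_cells c' K col X"
proof -
  have g: "part k col c' = part k col c" if "k \<in> K" for k using e that by (auto simp: part_def)
  have n: "known_with c' K v = known_with c K v" if "v \<in> part k col c" "k \<in> K" for v k
    using e that by (auto simp: known_with_def part_def)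
  have "key_of p \<in> K" if "p \<in> set X" for p using X that unfolding class_cells_def by auto
  then show ?thesis using X g n unfolding class_cells_def by (auto 4 4)
qed

lemma trio_cells_cong:
  assumes e: "\<forall>v\<in>V - {w}. key cs v \<in> K \<longrightarrow> c' v = c v" and u: "trio_cells c K u"
  shows "trio_cells c' K u"
proof -
  have "{v\<in>V - {w}. key cs v \<in> K \<and> c' v = col} = {v\<in>V - {w}. key cs v \<in> K \<and> c v = col}" for col
    using e by auto
  then show ?thesis using u class_cells_cong[OF e] by (auto simp: trio_cells_def split: trio.splits)
qed

lemma colour_cards:
  assumes c: "punctured w c"
  shows "card {v\<in>V - {w}. key cs v = k} = card (part k Red c) + card (part k Green c) +
      card (part k Blue c)"
proof -
  have e: "{v\<in>V - {w}. key cs v = k} = part k Red c \<union> (part k Green c \<union> part k Blue c)"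
    using c by (auto simp: part_def punctured_def) (metis colour.exhaust)
  have "card (part k Red c \<union> (part k Green c \<union> part k Blue c)) = card (part k Red c) +
    card (part k Green c \<union> part k Blue c)"
    by (intro card_Un_disjoint) (auto simp: finite_part, auto simp: part_def)
  moreover have "card (part k Green c \<union> part k Blue c) = card (part k Green c) + card (part k Blue c)"
    by (intro card_Un_disjoint) (auto simp: finite_part, auto simp: part_def)
  ultimately show ?thesis unfolding e by simp
qed

text \<open>The enumeration is complete: going through the cells, the unused colours are renamed so that the
  split of the present cell is \<open>ordered\<close>, and then this split is one of those tried. No colouring
  that exists is lost by a lack of slack or room.\<close>

lemma spread_correct:
  assumes "punctured w c" "trio_cells c K u" "m \<le> 3"
    and "\<forall>v\<in>V - {w}. key cs v \<in> K \<longrightarrow> c v \<in> set (take m [Red, Green, Blue])"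
    and "distinct (map key_of todo)" "key_of ` set todo \<inter> K = {}"
    and "\<forall>p\<in>set todo. size_of p = card {v\<in>V - {w}. key cs v = key_of p} \<and> 0 < size_of p \<and>
       (\<forall>v\<in>V - {w}. key cs v = key_of p \<longrightarrow> slack_of p + card (known cs v) = D)"
  shows "\<exists>c' u'. recoloured c c' \<and> u' \<in> set (spread todo m u) \<and>
      trio_cells c' (K \<union> key_of ` set todo) u'"
  using assms
proof (induction todo arbitrary: c K u m)
  case Nil
  then show ?case using recoloured_refl by auto
next
  case (Cons p todo)
  obtain n s i h where p: "p = Cell n s i h" by (cases p)
  let ?k = "(i, h)"
  obtain c1 where c1: "recoloured c c1" "ordered m (card (part ?k Red c1), card (part ?k Green c1),
    card (part ?k Blue c1))"
    "\<forall>v\<in>V - {w}. key cs v \<in> K \<longrightarrow> c1 v = c v"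
    using sort_colours[OF Cons.prems(3,4)] by blast
  let ?t = "(card (part ?k Red c1), card (part ?k Green c1), card (part ?k Blue c1))"
  have pc1: "punctured w c1" using recoloured_punctured[OF c1(1) Cons.prems(1)] .
  have k: "?k \<notin> K" using Cons.prems(6) p by auto
  have s: "s + card (known cs v) = D" if "v \<in> V - {w}" "key cs v = ?k" for v
    using Cons.prems(7) that p by auto
  obtain u1 where u1: "place ?t s i h u = Some u1" "trio_cells c1 (insert ?k K) u1"
    using place_correct[OF pc1 trio_cells_cong[OF c1(3) Cons.prems(2)] k s] by auto
  have n: "n = card (part ?k Red c1) + card (part ?k Green c1) + card (part ?k Blue c1)" "0 < n"
    using Cons.prems(7) p colour_cards[OF pc1, of ?k] by auto
  have m3: "opened m ?t \<le> 3" using Cons.prems(3) by (auto simp: opened_def)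
  have cm: "c1 v \<in> set (take (opened m ?t) [Red, Green, Blue])"
    if v: "v \<in> V - {w}" "key cs v \<in> insert ?k K" for v
  proof (cases "key cs v \<in> K")
    case True
    have tk: "set (take m [Red, Green, Blue]) \<subseteq> set (take (opened m ?t) [Red, Green, Blue])"
      by (rule set_take_subset_set_take) (use Cons.prems(3) in \<open>auto simp: opened_def\<close>)
    show ?thesis using Cons.prems(4) c1(3) v(1) True tk by auto
  next
    case False
    then have kv: "key cs v = ?k" using v by auto
    then have "v \<in> part ?k (c1 v) c1" using v by (auto simp: part_def)
    then have "0 < card (part ?k (c1 v) c1)" using finite_part by (auto simp: card_gt_0_iff)
    moreover have "c1 v \<noteq> Blank" using pc1 v by (auto simp: punctured_def)
    ultimately show ?thesis by (intro in_take3) (auto simp: opened_def)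
  qed
  have "\<exists>c' u'. recoloured c1 c' \<and> u' \<in> set (spread todo (opened m ?t) u1) \<and>
    trio_cells c' (insert ?k K \<union> key_of ` set todo) u'"
    by (rule Cons.IH[OF pc1 u1(2) m3]) (use cm Cons.prems(5-7) p in auto)
  then obtain c' u' where c': "recoloured c1 c'" "u' \<in> set (spread todo (opened m ?t) u1)"
    "trio_cells c' (insert ?k K \<union> key_of ` set todo) u'"
    by blast
  have "?t \<in> set (splits n)" using n(1) by (auto simp: set_splits)
  then have "u' \<in> set (spread (p # todo) m u)"
    unfolding p using c1(2) c'(2) u1(1) by (auto intro!: bexI[of _ ?t])
  then show ?case using c' recoloured_trans[OF c1(1)] p by auto
qed

end

end

section \<open>Completeness of the search\<close>

lemma mset_weave: "mset (weave X Y Z W) = image_mset (paint Red) (mset X) +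
  image_mset (paint Green) (mset Y) + image_mset (paint Blue) (mset Z) + mset W"
  by (induction X Y Z W rule: weave.induct) auto

lemma mset_sift: "mset (sift c cs X Y Z) = mset cs + mset X + mset Y + mset Z"
  by (induction c cs X Y Z rule: sift.induct) auto

lemma mset_chain: "mset (chain fs cs) = mset cs"
  by (induction fs cs rule: chain.induct) (auto simp: mset_sift)

lemma mset_insert_cell: "mset (insert_cell c cs) = add_mset c (mset cs)"
  by (induction c cs rule: insert_cell.induct) auto

lemma mset_arrange: "mset (arrange cs) = mset cs"
proof -
  have "mset (foldr insert_cell cs []) = mset cs" by (induction cs) (auto simp: mset_insert_cell)
  then show ?thesis by (simp add: arrange_def mset_chain)
qed

lemma mset_pickR: "pickR acc cs = Some (c, cs') \<Longrightarrow> add_mset c (mset cs') = mset acc + mset cs"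
  by (induction acc cs rule: pickR.induct) (auto split: if_splits)

lemma mset_pick: "pick q acc cs = Some (c, cs') \<Longrightarrow>
   add_mset c (mset cs') = mset acc + mset cs + (case q of None \<Rightarrow> {#} | Some d \<Rightarrow> {#d#})"
  by (induction q acc cs rule: pick.induct) (auto split: if_splits dest: mset_pickR)

lemma key_of_paint: "key_of (paint k p) = (fst (key_of p), k # snd (key_of p))" by (cases p) auto

lemma size_of_paint: "size_of (paint k p) = size_of p" by (cases p) auto

lemma slack_of_paint: "slack_of (paint k p) = slack_of p" by (cases p) auto

text \<open>Pairwise linked vertices: a cell that is not linked to itself must be a single vertex.\<close>

definition clique :: "cell list \<Rightarrow> bool" where
  "clique X \<longleftrightarrow> (\<forall>p\<in>set X. \<forall>q\<in>set X. p = q \<and> size_of p = 1 \<or> linked_keys (key_of p) (key_of q))"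

lemma linked_Nil: "linked i [] j [] \<longleftrightarrow> i \<and> j" by (cases i; cases j) auto

lemma fits_iff: "fits i h X \<longleftrightarrow> (\<forall>q\<in>set X. linked_keys (i, h) (key_of q))"
proof (induction X)
  case (Cons q X) then show ?case by (cases q) (auto simp: linked_keys_def)
qed simp

lemma clique_Cons:
  "n = 1 \<or> linked i h i h \<Longrightarrow> fits i h X \<Longrightarrow> clique X \<Longrightarrow> clique (Cell n s i h # X)"
  by (auto simp: clique_def fits_iff linked_keys_sym) (auto simp: linked_keys_def)

lemma tricol_cliques:
  "tricol cs X Y Z \<Longrightarrow> clique X \<Longrightarrow> clique Y \<Longrightarrow> clique Z \<Longrightarrow>
   \<exists>X' Y' Z'. clique X' \<and> clique Y' \<and> clique Z' \<and> set X' \<union> set Y' \<union> set Z' = set cs \<union> set X \<union> set Y \<union>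
       set Z"
proof (induction cs X Y Z rule: tricol.induct)
  case (1 X Y Z)
  then show ?case by (intro exI[of _ X] exI[of _ Y] exI[of _ Z]) auto
next
  case (2 n s i h cs X Y Z)
  let ?c = "Cell n s i h"
  have self: "n = 1 \<or> linked i h i h" using 2(4) by simp
  consider "fits i h X" "tricol cs (?c # X) Y Z" | "fits i h Y" "tricol cs X (?c # Y) Z"
    | "fits i h Z" "tricol cs X Y (?c # Z)" using 2(4) by auto
  then show ?case
  proof cases
    case 1
    then show ?thesis using 2(1)[OF 1(2)] 2(5-7) clique_Cons[OF self 1(1)]
      by (simp add: Un_ac insert_commute)
  next
    case a: 2
    then show ?thesis using 2(2)[OF a(2)] 2(5-7) clique_Cons[OF self a(1)]
      by (simp add: Un_ac insert_commute)
  next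
    case a: 3
    then show ?thesis using 2(3)[OF a(2)] 2(5-7) clique_Cons[OF self a(1)]
      by (simp add: Un_ac insert_commute)
  qed
qed

context critical_config begin

lemma recoloured_concentration:
  assumes "recoloured c c'"
  shows "Max ((\<lambda>k. card {v\<in>I. c' v = k}) ` {Red, Green, Blue}) =
      Max ((\<lambda>k. card {v\<in>I. c v = k}) ` {Red, Green, Blue})"
proof -
  obtain p where p: "inj p" "p Blank = Blank" "c' = p \<circ> c" using assms by (auto simp: recoloured_def)
  have U: "UNIV = {Blank, Red, Green, Blue}" by (auto intro: colour.exhaust)
  have fin: "finite (UNIV :: colour set)" unfolding U by simp
  then have "surj p" using p(1) finite_UNIV_inj_surj by blast
  then have "p ` {Red, Green, Blue} = UNIV - {Blank}"
    using p(1,2) U by (metis (no_types, lifting) Diff_insert_absorb image_set_diff image_insert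
      image_empty
      insertE colour.distinct(1,3,5) empty_iff)
  then have pi: "p ` {Red, Green, Blue} = {Red, Green, Blue}" using U by auto
  have "card {v\<in>I. c' v = p k} = card {v\<in>I. c v = k}" for k using p by (auto simp: inj_eq)
  then have "(\<lambda>k. card {v\<in>I. c v = k}) ` {Red, Green, Blue} =
    (\<lambda>k. card {v\<in>I. c' v = p k}) ` {Red, Green, Blue}" by simp
  also have "\<dots> = (\<lambda>k. card {v\<in>I. c' v = k}) ` p ` {Red, Green, Blue}" by (simp add: image_image)
  finally show ?thesis unfolding pi by simp
qed

text \<open>This number does not depend on the names of the colours, unlike the sizes of the single classes, and
  can therefore be compared for colourings that are chosen separately.\<close>

definition concentration :: "('a \<Rightarrow> colour) \<Rightarrow> nat" where
  "concentration c = Max ((\<lambda>k. card {v\<in>I. c v = k}) ` {Red, Green, Blue})"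

lemma finite_I: "finite I" using IV finV finite_subset by blast

lemma count_I_correct:
  assumes pcs: "\<forall>c\<in>set cs. partial c" and wV: "w \<in> V" and c: "punctured w c"
    and X: "class_cells cs w c K col X" and col: "col \<noteq> Blank" and K: "\<forall>v\<in>V - {w}. key cs v \<in> K"
  shows "count_I X = card {v\<in>I. c v = col}"
proof -
  have "count_I Y = (\<Sum>p\<leftarrow>filter (\<lambda>p. fst (key_of p)) Y. size_of p)" for Y
    by (induction Y rule: count_I.induct) auto
  then have "count_I X = card (\<Union>p\<in>set (filter (\<lambda>p. fst (key_of p)) X). part cs w (key_of p) col c)"
    using sum_cells[OF pcs wV, where X = X and c = c and col = col and Q = "\<lambda>p. fst (key_of p)"] X
      by (simp add: class_cells_def[OF pcs wV])
  also have "(\<Union>p\<in>set (filter (\<lambda>p. fst (key_of p)) X). part cs w (key_of p) col c) = {v\<in>I. c v = col}"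
  proof (intro equalityI subsetI)
    fix v assume "v \<in> (\<Union>p\<in>set (filter (\<lambda>p. fst (key_of p)) X). part cs w (key_of p) col c)"
    then show "v \<in> {v\<in>I. c v = col}" by (auto simp: part_def[OF pcs wV] key_def) (metis fst_conv)
  next
    fix v assume v: "v \<in> {v\<in>I. c v = col}"
    then have vw: "v \<in> V - {w}" using IV c col by (auto simp: punctured_def)
    then have g: "v \<in> part cs w (key cs v) col c" using v by (auto simp: part_def[OF pcs wV])
    then have "key cs v \<in> key_of ` set X" using X K vw unfolding class_cells_def[OF pcs wV] by auto
    then obtain p where "p \<in> set X" "key_of p = key cs v" by (metis imageE)
    then show "v \<in> (\<Union>p\<in>set (filter (\<lambda>p. fst (key_of p)) X). part cs w (key_of p) col c)"
      using g v by (auto simp: key_def)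
  qed
  finally show ?thesis .
qed

text \<open>Once \<open>c\<close> has been revealed on all vertices other than \<open>w\<close>, the
  non-neighbours known with it are those that the new keys show, as the blank vertex \<open>w\<close> shares its
  colour with nobody.\<close>

lemma record_colouring_correct:
  assumes S: "represents cs st" and p: "Cell n s i h \<in> set st" and wV: "w \<in> V"
      and kw: "key cs w = (i, h)"
    and c: "punctured w c" and u: "trio_cells cs w c K u"
      and K: "\<forall>v\<in>V - {w}. key cs v \<in> K" "K \<subseteq> key cs ` (V - {w})"
  shows "represents (c # cs) (record_colouring (Cell n s i h) u)"
proof -
  obtain a b d X Y Z where U: "u = Trio a b d X Y Z" by (cases u)
  have pcs: "\<forall>c\<in>set cs. partial c" using S by (simp add: represents_def)
  note defs = part_def[OF pcs wV] known_with_def[OF pcs wV] class_cells_def[OF pcs wV]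
  have IX: "class_cells cs w c K Red X" "class_cells cs w c K Green Y" "class_cells cs w c K Blue Z"
    using u unfolding U by (auto simp: trio_cells_def[OF pcs wV])
  let ?w = "Cell 1 s i (Blank # h)"
  let ?st = "record_colouring (Cell n s i h) u"
  have m: "mset ?st = image_mset (paint Red) (mset X) + image_mset (paint Green) (mset Y) +
    image_mset (paint Blue) (mset Z) + {#?w#}"
    unfolding U by (simp add: mset_weave)
  have st: "set ?st = paint Red ` set X \<union> paint Green ` set Y \<union> paint Blue ` set Z \<union> {?w}"
    using arg_cong[OF m, of set_mset] by simp
  have key': "key (c # cs) v = (fst (key cs v), c v # snd (key cs v))" for v by (simp add: key_def)
  have cw: "c w = Blank" and cv: "v \<in> V \<Longrightarrow> v \<noteq> w \<Longrightarrow> c v \<noteq> Blank" for v using c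
    by (auto simp: punctured_def)
  have part: "\<forall>c\<in>set (c # cs). partial c" using pcs c by (simp add: punctured_def)
  have cell: "size_of (paint col q) = card {v\<in>V. key (c # cs) v = key_of (paint col q)} \<and>
      (\<forall>v\<in>V. key (c # cs) v = key_of (paint col q) \<longrightarrow> slack_of (paint col q) + card (known (c # cs) v) =
          D)"
    if "class_cells cs w c K col W" "q \<in> set W" "col \<noteq> Blank" for col W q
  proof -
    have e: "{v\<in>V. key (c # cs) v = key_of (paint col q)} = part cs w (key_of q) col c"
      using that(3) cw by (auto simp: defs key' key_of_paint prod_eq_iff)
    have kn: "known (c # cs) v = known_with cs w c K v" if "v \<in> part cs w (key_of q) col c" for v
    proof -
      have "v \<in> V" "v \<noteq> w" using that by (auto simp: defs)
      then have "c v \<noteq> Blank" by (rule cv)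
      then show ?thesis using K(1) cw
        by (auto simp: known_def defs linked_keys_iff)
    qed
    show ?thesis
    proof (intro conjI ballI impI)
      show "size_of (paint col q) = card {v\<in>V. key (c # cs) v = key_of (paint col q)}"
        unfolding e size_of_paint using that unfolding defs(3) by auto
      fix v assume "v \<in> V" "key (c # cs) v = key_of (paint col q)"
      then have v: "v \<in> part cs w (key_of q) col c" using e by blast
      then show "slack_of (paint col q) + card (known (c # cs) v) = D"
        unfolding slack_of_paint kn[OF v] using that unfolding defs(3) by auto
    qed
  qed
  \<comment> \<open>The blank vertex shares its colour with nobody, so nothing new is known about it.\<close>
  have wcell: "size_of ?w = card {v\<in>V. key (c # cs) v = key_of ?w} \<and>
      (\<forall>v\<in>V. key (c # cs) v = key_of ?w \<longrightarrow> slack_of ?w + card (known (c # cs) v) = D)"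
  proof -
    have e: "{v\<in>V. key (c # cs) v = key_of ?w} = {w}"
      using cv cw wV kw by (auto simp: key' prod_eq_iff)
    have kn: "known (c # cs) w = known cs w" using cw by (auto simp: known_def linked_keys_iff)
    have sw: "s + card (known cs w) = D" using S p wV kw unfolding represents_def by fastforce
    have vw: "v = w" if "v \<in> V" "key (c # cs) v = key_of ?w" for v using e that by blast
    show ?thesis unfolding e using vw kn sw by auto
  qed
  have dX: "distinct (map key_of (map (paint col) W))" if "class_cells cs w c K col W" for col W
  proof -
    have e: "map key_of (map (paint col) W) = map (\<lambda>(i, h). (i, col # h)) (map key_of W)"
      by (simp add: key_of_paint case_prod_beta)
    have "inj (\<lambda>(i :: bool, h). (i, col # h))" by (auto simp: inj_def)
    then have "inj_on (\<lambda>(i :: bool, h). (i, col # h)) (set (map key_of W))" by (rule inj_on_subset) simp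
    moreover have "distinct (map key_of W)" using that unfolding defs(3) by blast
    ultimately show ?thesis unfolding e by (simp only: distinct_map)
  qed
  have "mset (map key_of ?st) = mset (map key_of (map (paint Red) X) @ map key_of (map (paint Green) Y)
    @ map key_of (map (paint Blue) Z) @ [key_of ?w])"
    using arg_cong[OF m, of "image_mset key_of"] by (simp add: image_mset.compositionality)
  moreover have "distinct (map key_of (map (paint Red) X) @ map key_of (map (paint Green) Y) @ map
    key_of (map (paint Blue) Z) @ [key_of ?w])"
    using dX[OF IX(1)] dX[OF IX(2)] dX[OF IX(3)] by (auto simp: key_of_paint)
  ultimately have d: "distinct (map key_of ?st)" by (metis mset_eq_imp_distinct_iff)
  have all: "\<forall>q\<in>set ?st. size_of q = card {v \<in> V. key (c # cs) v = key_of q} \<and>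
    (\<forall>v\<in>V. key (c # cs) v = key_of q \<longrightarrow> slack_of q + card (known (c # cs) v) = D)"
    unfolding st using cell[OF IX(1)] cell[OF IX(2)] cell[OF IX(3)] wcell by blast
  have ks: "key_of ` set ?st = key (c # cs) ` V"
  proof (intro equalityI subsetI)
    fix k assume "k \<in> key_of ` set ?st"
    then obtain q where q: "q \<in> set ?st" "k = key_of q" by auto
    have "size_of q \<noteq> 0"
    proof -
      have "size_of (paint col r) \<noteq> 0" if "class_cells cs w c K col W" "r \<in> set W" for col W r
      proof -
        have "key_of r \<in> key_of ` set W" using that by auto
        then have "part cs w (key_of r) col c \<noteq> {}" using that(1) unfolding defs(3) by auto
        then show ?thesis using that finite_part[OF pcs wV] unfolding defs(3) size_of_paint by auto
      qed
      then show ?thesis using q(1) IX unfolding st by auto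
    qed
    then have "card {v\<in>V. key (c # cs) v = key_of q} \<noteq> 0" using all q(1) by auto
    then have "{v\<in>V. key (c # cs) v = key_of q} \<noteq> {}" by (metis card.empty)
    then obtain v where "v \<in> V" "key (c # cs) v = key_of q" by blast
    then show "k \<in> key (c # cs) ` V" using q by (metis image_eqI)
  next
    fix k assume "k \<in> key (c # cs) ` V"
    then obtain v where v: "v \<in> V" "k = key (c # cs) v" by auto
    show "k \<in> key_of ` set ?st"
    proof (cases "v = w")
      case True
      then have "k = key_of ?w" using v kw cw by (simp add: key')
      then show ?thesis unfolding st by blast
    next
      case False
      have sub: "k \<in> key_of ` paint (c v) ` set W" if "class_cells cs w c K (c v) W" for W
      proof -
        have "v \<in> part cs w (key cs v) (c v) c" using v False by (auto simp: defs)
        then have "key cs v \<in> key_of ` set W" using that K v False unfolding defs(3) by auto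
        then obtain q where q: "q \<in> set W" "key_of q = key cs v" by (metis imageE)
        then have "k = key_of (paint (c v) q)" using v by (simp add: key_of_paint key')
        then show ?thesis using q(1) by blast
      qed
      have "c v = Red \<Longrightarrow> k \<in> key_of ` paint Red ` set X" "c v = Green \<Longrightarrow> k \<in> key_of ` paint Green ` set Y"
        "c v = Blue \<Longrightarrow> k \<in> key_of ` paint Blue ` set Z" using sub[of X] sub[of Y] sub[of Z] IX by auto
      moreover have "c v = Red \<or> c v = Green \<or> c v = Blue" using cv[OF v(1) False] by (cases "c v") auto
      ultimately show ?thesis unfolding st by blast
    qed
  qed
  show ?thesis unfolding represents_def
  proof (intro conjI)
    show "\<forall>q\<in>set ?st. size_of q = card {v \<in> V. key (c # cs) v = key_of q} \<and>
      (\<forall>v\<in>V. key (c # cs) v = key_of q \<longrightarrow> slack_of q + card (known (c # cs) v) = D)" by (rule all)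
  qed (use part d ks in auto)
qed

text \<open>The deleted vertex \<open>w\<close> may be any vertex of the chosen cell, since vertices of the same
  cell are indistinguishable so far.\<close>

lemma extensions_correct:
  assumes S: "represents cs st" and st: "mset st = add_mset g (mset rest)" and wV: "w \<in> V"
      and kw: "key cs w = key_of g"
    and c: "punctured w c"
  shows "\<exists>c' u. recoloured c c' \<and> u \<in> set (extensions al g rest) \<and> trio_concentration u =
      concentration c \<and> represents (c' # cs) (record_colouring g u)"
proof -
  obtain n s i h where g: "g = Cell n s i h" by (cases g)
  have pcs: "\<forall>c\<in>set cs. partial c" using S by (simp add: represents_def)
  have gst: "set st = insert g (set rest)" using arg_cong[OF st, of set_mset] by simp
  have "mset (map key_of st) = mset (key_of g # map key_of rest)"
    using arg_cong[OF st, of "image_mset key_of"] by simp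
  then have dr: "distinct (key_of g # map key_of rest)" using S unfolding represents_def
    by (metis mset_eq_imp_distinct_iff)
  let ?todo = "arrange (less1 g rest)"
  have ng: "n = card {v\<in>V. key cs v = (i, h)}" using S gst g by (auto simp: represents_def)
  have eg: "{v\<in>V - {w}. key cs v = (i, h)} = {v\<in>V. key cs v = (i, h)} - {w}" by auto
  have ng1: "card {v\<in>V - {w}. key cs v = (i, h)} = n - 1"
    unfolding eg ng using wV kw g finV by (simp add: card_Diff_singleton)
  have mt: "mset ?todo = mset (less1 g rest)" by (rule mset_arrange)
  have sett: "set ?todo = set (less1 g rest)" using arg_cong[OF mt, of set_mset] by simp
  have d: "distinct (map key_of ?todo)"
  proof -
    have "mset (map key_of ?todo) = mset (map key_of (less1 g rest))" using mt by (metis mset_map)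
    moreover have "distinct (map key_of (less1 g rest))" using dr g by auto
    ultimately show ?thesis by (metis mset_eq_imp_distinct_iff)
  qed
  have ne: "{v\<in>V - {w}. key cs v = key_of q} \<noteq> {}" if "q \<in> set rest" for q
  proof -
    have "key_of q \<in> key cs ` V" using S gst that unfolding represents_def by (metis image_eqI insertI2)
    moreover have "key_of q \<noteq> key_of g" using dr imageI[OF that, of key_of] by auto
    ultimately show ?thesis using kw by auto
  qed
  have todo: "size_of q = card {v\<in>V - {w}. key cs v = key_of q} \<and> 0 < size_of q \<and>
       (\<forall>v\<in>V - {w}. key cs v = key_of q \<longrightarrow> slack_of q + card (known cs v) = D)" if q: "q
           \<in> set ?todo" for q
  proof -
    \<comment> \<open>The cell of \<open>w\<close> has lost a vertex and is dropped if no other one is left.\<close>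
    consider "q \<in> set rest" | "n > 1" "q = Cell (n - 1) s i h" using q g sett by (auto split: if_splits)
    then show ?thesis
    proof cases
      case 1
      have kq: "key_of q \<noteq> key_of g" using dr imageI[OF 1, of key_of] by auto
      then have e: "{v\<in>V - {w}. key cs v = key_of q} = {v\<in>V. key cs v = key_of q}" using kw by auto
      have "finite {v\<in>V - {w}. key cs v = key_of q}" using finV by auto
      then have "0 < card {v\<in>V - {w}. key cs v = key_of q}" using ne[OF 1] by (simp add: card_gt_0_iff)
      then show ?thesis using S gst 1 e unfolding represents_def by auto
    next
      case 2
      have "\<forall>v\<in>V. key cs v = (i, h) \<longrightarrow> s + card (known cs v) = D" using S gst g unfolding represents_def
        by auto
      then show ?thesis using 2 ng1 by auto
    qed
  qed
  have Inv0: "trio_cells cs w c {} (Trio al al al [] [] [])"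
    by (simp add: trio_cells_def[OF pcs wV] class_cells_def[OF pcs wV])
  have todo': "\<forall>q\<in>set ?todo. size_of q = card {v\<in>V - {w}. key cs v = key_of q} \<and> 0 < size_of q \<and>
       (\<forall>v\<in>V - {w}. key cs v = key_of q \<longrightarrow> slack_of q + card (known cs v) = D)" using todo by blast
  have "\<exists>c' u'. recoloured c c' \<and> u' \<in> set (spread ?todo 0 (Trio al al al [] [] [])) \<and>
    trio_cells cs w c' ({} \<union> key_of ` set ?todo) u'"
    by (rule spread_correct[OF pcs wV c Inv0 _ _ d _ todo']) auto
  then obtain c' u where r: "recoloured c c'" and u: "u \<in> set (extensions al g rest)"
    and I: "trio_cells cs w c' (key_of ` set ?todo) u"
    by (auto simp: extensions_def)
  have c': "punctured w c'" using recoloured_punctured[OF r c] .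
  have K: "\<forall>v\<in>V - {w}. key cs v \<in> key_of ` set ?todo"
  proof
    fix v assume v: "v \<in> V - {w}"
    then have "key cs v \<in> key_of ` set st" using S by (auto simp: represents_def)
    then consider "key cs v = key_of g" | "key cs v \<in> key_of ` set rest" using gst by auto
    then show "key cs v \<in> key_of ` set ?todo"
    proof cases
      case 1
      then have "v \<in> {v\<in>V - {w}. key cs v = (i, h)}" using v g by auto
      then have "0 < n - 1" unfolding ng1[symmetric] using finV by (auto simp: card_gt_0_iff)
      then show ?thesis unfolding sett using 1 g by auto
    next
      case 2 then show ?thesis unfolding sett using g by auto
    qed
  qed
  have K2: "key_of ` set ?todo \<subseteq> key cs ` (V - {w})"
  proof
    fix k assume "k \<in> key_of ` set ?todo"
    then obtain q where q: "q \<in> set ?todo" "k = key_of q" by auto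
    then have "card {v\<in>V - {w}. key cs v = key_of q} \<noteq> 0" using todo[OF q(1)] by auto
    then have "{v\<in>V - {w}. key cs v = key_of q} \<noteq> {}" by (metis card.empty)
    then obtain v where "v \<in> V - {w}" "key cs v = key_of q" by blast
    then show "k \<in> key cs ` (V - {w})" using q by (metis image_eqI)
  qed
  have "Cell n s i h \<in> set st" using gst g by auto
  then have Sem': "represents (c' # cs) (record_colouring g u)"
    using record_colouring_correct[OF S _ wV _ c' I K K2] kw g by auto
  obtain a b e X Y Z where U: "u = Trio a b e X Y Z" by (cases u)
  have "trio_concentration u = concentration c'"
  proof -
    have "class_cells cs w c' (key_of ` set ?todo) Red X"
      "class_cells cs w c' (key_of ` set ?todo) Green Y"
      "class_cells cs w c' (key_of ` set ?todo) Blue Z"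
      using I U by (auto simp: trio_cells_def[OF pcs wV])
    note this[THEN count_I_correct[OF pcs wV c', rotated -1, OF K]]
    then show ?thesis by (simp add: U concentration_def max.commute max.left_commute)
  qed
  then have "trio_concentration u = concentration c" using recoloured_concentration[OF r]
    by (simp add: concentration_def)
  then show ?thesis using r u Sem' by blast
qed

text \<open>Linked vertices are not adjacent, so that three sets of pairwise linked vertices are colour
  classes.\<close>

lemma tricol_correct:
  assumes S: "represents cs st" and t: "tricol st [] [] []"
  shows "\<exists>c. partial c \<and> (\<forall>v\<in>V. c v \<noteq> Blank)"
proof -
  obtain X Y Z where XYZ: "clique X" "clique Y" "clique Z" "set X \<union> set Y \<union> set Z = set st"
    using tricol_cliques[OF t] by (auto simp: clique_def)
  let ?c = "\<lambda>v. if key cs v \<in> key_of ` set X then Red else if key cs v \<in> key_of ` set Y then Green else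
     if key cs v \<in> key_of ` set Z then Blue else Blank"
  have pcs: "\<forall>c\<in>set cs. partial c" using S by (simp add: represents_def)
  have ind: "\<not> adj u v" if W: "clique W" "set W \<subseteq> set st" and uv: "u \<in> V" "v \<in> V" "u \<noteq> v"
    "key cs u \<in> key_of ` set W" "key cs v \<in> key_of ` set W" for W u v
  proof -
    obtain p q where p: "p \<in> set W" "key_of p = key cs u" and q: "q \<in> set W" "key_of q = key cs v"
      using uv by (metis imageE)
    consider "p = q" "size_of p = 1" | "linked_keys (key_of p) (key_of q)" using W(1) p q
      unfolding clique_def by blast
    then show ?thesis
    proof cases
      case 1
      then have "card {x\<in>V. key cs x = key_of p} = 1" using S W(2) p unfolding represents_def by auto
      then obtain x where "{x\<in>V. key cs x = key_of p} = {x}" by (auto simp: card_1_singleton_iff)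
      then have "u = x" "v = x" using 1 p q uv by auto
      then show ?thesis using uv by simp
    next
      case 2
      then show ?thesis using linked_nonadj[OF pcs] uv p q by auto
    qed
  qed
  have "partial ?c" unfolding partial_def
  proof (intro ballI impI)
    fix u v assume uv: "u \<in> V" "v \<in> V" "u \<noteq> v" and eq: "?c u = ?c v" and ne: "?c u \<noteq> Blank"
    consider "key cs u \<in> key_of ` set X" "key cs v \<in> key_of ` set X" | "key cs u \<in> key_of ` set Y"
      "key cs v \<in> key_of ` set Y"
      | "key cs u \<in> key_of ` set Z" "key cs v \<in> key_of ` set Z" using eq ne by (metis colour.distinct)
    then show "\<not> adj u v"
      using ind[OF XYZ(1) _ uv] ind[OF XYZ(2) _ uv] ind[OF XYZ(3) _ uv] XYZ(4) by cases blast+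
  qed
  moreover have "?c v \<noteq> Blank" if "v \<in> V" for v
  proof -
    have "key cs v \<in> key_of ` (set X \<union> set Y \<union> set Z)" using S that unfolding XYZ(4) represents_def
      by auto
    then show ?thesis by (auto simp: image_Un)
  qed
  ultimately show ?thesis by blast
qed

end

text \<open>Vertex-criticality in the form in which it is used: \<open>G\<close> has no 3-colouring, but each
  vertex-deleted subgraph does.\<close>

locale critical4 = critical_config +
  assumes not3: "\<not> (\<exists>c. partial c \<and> (\<forall>v\<in>V. c v \<noteq> Blank))"
    and crit: "w \<in> V \<Longrightarrow> \<exists>c. punctured w c"
begin

text \<open>Each picked vertex has a 3-colouring of its deletion, and this colouring is one of the branches.
  Following it, the search must arrive at a state that represents \<open>G\<close>; no such state is
  contradictory, so the branch ends in \<open>Ls\<close>.\<close>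

lemma refuted_correct:
  assumes "refuted f al r Ls st" "represents cs st" "\<And>w c. w \<in> I \<Longrightarrow> punctured w c \<Longrightarrow> r \<le> concentration c"
  shows "\<exists>cs' st'. st' \<in> set Ls \<and> represents cs' st'"
  using assms
proof (induction f arbitrary: cs st)
  case 0
  then show ?case by auto
next
  case (Suc f)
  have nt: "\<not> tricol st [] [] []" using tricol_correct[OF Suc.prems(2)] not3 by blast
  show ?case
  proof (cases "pick None [] st")
    case None
    then show ?thesis using Suc.prems(1,2) nt by auto
  next
    case (Some gr)
    obtain g rest where gr: "pick None [] st = Some (g, rest)" using Some by (cases gr) auto
    have m: "mset st = add_mset g (mset rest)" using mset_pick[OF gr] by simp
    have "g \<in> set st" using arg_cong[OF m, of set_mset] by simp
    then have "key_of g \<in> key cs ` V" using Suc.prems(2) unfolding represents_def by (metis imageI)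
    then obtain w where w: "w \<in> V" "key cs w = key_of g" by (metis imageE)
    obtain c where c: "punctured w c" using crit[OF w(1)] by blast
    obtain c' u where u: "u \<in> set (extensions al g rest)" "trio_concentration u = concentration c"
      "represents (c' # cs) (record_colouring g u)"
      using extensions_correct[OF Suc.prems(2) m w c] by blast
    have "\<not> small r g u"
    proof -
      obtain n s i h where g: "g = Cell n s i h" by (cases g)
      have "i \<longleftrightarrow> w \<in> I" using w(2) g by (auto simp: key_def)
      then show ?thesis using Suc.prems(3)[OF _ c] u(2) g by auto
    qed
    then have "refuted f al r Ls (record_colouring g u)" using Suc.prems(1) nt gr u(1)
      by (auto simp: list_all_iff)
    then show ?thesis using Suc.IH[OF _ u(3)] Suc.prems(3) by blast
  qed
qed

text \<open>Among all 3-colourings of \<open>G - a\<close> with \<open>a \<in> I\<close> there is one of least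
  concentration \<open>r\<close>. The search for this \<open>r\<close> starts with it, so that all later ones of
  this kind satisfy the bound that the search relies on. Since \<open>a\<close> itself is blank,
  \<open>r\<close> is less than \<open>\<bar>I\<bar>\<close>.\<close>

lemma search_correct:
  assumes al: "0 < al" and n: "card V = n" and D: "D = n - 7" and aln: "al < n"
    and search: "\<And>r. r < al \<Longrightarrow> search n al Ls r"
  shows "\<exists>cs st. st \<in> set Ls \<and> represents cs st"
proof -
  define A where "A = {concentration c | w c. w \<in> I \<and> punctured w c}"
  obtain a where a: "a \<in> I" using al cardI by (metis card.empty equals0I less_irrefl)
  have "A \<noteq> {}" using crit a IV unfolding A_def by blast
  \<comment> \<open>The least concentration that occurs is attained.\<close>
  then have "Inf A \<in> A" by (rule Inf_nat_def1)
  then obtain w c where w: "w \<in> I" "punctured w c" "Inf A = concentration c" unfolding A_def by blast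
  define r where "r = concentration c"
  have min: "r \<le> concentration c'" if "w' \<in> I" "punctured w' c'" for w' c'
    using that w(3) unfolding r_def A_def
      by (metis (mono_tags, lifting) cInf_lower mem_Collect_eq bdd_below_bot)
  have "card {v\<in>I. c v = k} < al" if "k \<noteq> Blank" for k
  proof -
    have "{v\<in>I. c v = k} \<subset> I" using w that by (auto simp: punctured_def)
    then show ?thesis using psubset_card_mono[OF finite_I] cardI by auto
  qed
  then have "r < al" unfolding r_def concentration_def by simp
  then have s: "search n al Ls r" by (rule search)
  let ?g = "Cell al (n - 7 - (al - 1)) True []" and ?r = "Cell (n - al) (n - 7) False []"
  \<comment> \<open>Before the first colouring only the pairs inside \<open>I\<close> are known to be non-adjacent.\<close>
  have kn: "known [] v = (if v \<in> I then I - {v} else {})" for v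
    using IV by (auto simp: known_def key_def linked_keys_def linked_Nil)
  have "represents [] [?g, ?r]"
    unfolding represents_def
  proof (intro conjI)
    have "\<exists>v\<in>V. v \<notin> I" using aln n cardI IV by (metis card_mono finite_I not_le subsetI)
    then show "key_of ` set [?g, ?r] = key [] ` V" using a IV by (auto simp: key_def)
    have 1: "{v\<in>V. key [] v = key_of ?g} = I" using IV by (auto simp: key_def)
    have 2: "{v\<in>V. key [] v = key_of ?r} = V - I" by (auto simp: key_def)
    have 3: "card (V - I) = n - al" using card_Diff_subset[OF finite_I IV] n cardI by simp
    have 4: "al - 1 \<le> D"
    proof -
      have "I - {a} \<subseteq> {u\<in>V. u \<noteq> a \<and> \<not> adj u a}" using IV indI a by auto
      moreover have "finite {u\<in>V. u \<noteq> a \<and> \<not> adj u a}" using finV by simp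
      ultimately have "card (I - {a}) \<le> card {u\<in>V. u \<noteq> a \<and> \<not> adj u a}" by (rule card_mono[rotated])
      then have "card (I - {a}) \<le> D" using deg[of a] a IV by auto
      then show ?thesis using a cardI finite_I by simp
    qed
    have 5: "card (I - {v}) = al - 1" if "v \<in> I" for v using that cardI finite_I by simp
    show "\<forall>p\<in>set [?g, ?r]. size_of p = card {v\<in>V. key [] v = key_of p} \<and>
      (\<forall>v\<in>V. key [] v = key_of p \<longrightarrow> slack_of p + card (known [] v) = D)"
      using 1 2 3 4 5 cardI D by (auto simp: kn key_def)
  qed auto
  then obtain c' u where u: "u \<in> set (extensions al ?g [?r])" "trio_concentration u = concentration c"
    "represents [c'] (record_colouring ?g u)"
    using extensions_correct[of "[]" "[?g, ?r]" ?g "[?r]" w c] w IV by (auto simp: key_def)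
  then have "refuted 10 al r Ls (record_colouring ?g u)" using s
    by (auto simp: search_def start_cell_def list_all_iff r_def)
  then show ?thesis using refuted_correct[OF _ u(3)] min by blast
qed

end

section \<open>Solved states determine the graph\<close>

context critical_config begin

text \<open>If all cells are single vertices without slack, then a vertex has no non-neighbours apart from the
  linked ones. The state thus tells the graph, and a labelling that turns links into non-edges is an
  isomorphism.\<close>

lemma leaf_determines_graph:
  fixes lab :: "nat list"
  assumes S: "represents cs st" and one: "\<forall>p\<in>set st. size_of p = 1 \<and> slack_of p = 0"
    and lab: "length lab = length st" "distinct lab"
    and Q: "\<And>i j. i < length st \<Longrightarrow> j < length st \<Longrightarrow> i \<noteq> j \<Longrightarrow>
      linked_keys (key_of (st ! i)) (key_of (st ! j)) \<longleftrightarrow> \<not> Q (lab ! i) (lab ! j)"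
  shows "\<exists>f. bij_betw f V (set lab) \<and> (\<forall>u\<in>V. \<forall>v\<in>V. u \<noteq> v \<longrightarrow> adj u v = Q (f u) (f v))"
proof -
  have pcs: "\<forall>c\<in>set cs. partial c" and d: "distinct (map key_of st)"
    and ks: "key_of ` set st = key cs ` V"
    using S by (auto simp: represents_def)
  have cards: "card {x\<in>V. key cs x = key_of p} = 1" "\<forall>v\<in>V. key cs v = key_of p \<longrightarrow> card (known cs v) = D"
    if "p \<in> set st" for p
    using S one that unfolding represents_def by simp_all
  have ex: "\<exists>i. i < length st \<and> key_of (st ! i) = key cs v" if "v \<in> V" for v
  proof -
    have "key cs v \<in> key_of ` set st" unfolding ks using that by (rule imageI)
    then obtain p where "p \<in> set st" "key_of p = key cs v" by (elim imageE) simp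
    then show ?thesis unfolding in_set_conv_nth by blast
  qed
  define g where "g v = (SOME i. i < length st \<and> key_of (st ! i) = key cs v)" for v
  have g: "g v < length st \<and> key_of (st ! g v) = key cs v" if "v \<in> V" for v
    unfolding g_def by (rule someI_ex[OF ex[OF that]])
  have inj: "inj_on g V"
  proof (rule inj_onI)
    fix u v assume uv: "u \<in> V" "v \<in> V" "g u = g v"
    have "card {x\<in>V. key cs x = key_of (st ! g v)} = 1" using cards[of "st ! g v"] g[OF uv(2)] nth_mem
      by blast
    then obtain x where "{x\<in>V. key cs x = key_of (st ! g v)} = {x}" by (auto simp: card_1_singleton_iff)
    moreover have "u \<in> {x\<in>V. key cs x = key_of (st ! g v)}" "v \<in> {x\<in>V. key cs x = key_of (st ! g v)}"
      using uv g[of u] g[of v] by simp_all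
    ultimately show "u = v" by simp
  qed
  have img: "g ` V = {..<length st}"
  proof (intro equalityI subsetI)
    fix i assume i: "i \<in> {..<length st}"
    then have "key_of (st ! i) \<in> key cs ` V" using ks by (metis imageI lessThan_iff nth_mem)
    then obtain v where v: "v \<in> V" "key_of (st ! i) = key cs v" by auto
    then have "g v = i" using d g[OF v(1)] i
      by (metis (no_types, lifting) length_map lessThan_iff nth_eq_iff_index_eq nth_map)
    then show "i \<in> g ` V" using v by auto
  qed (use g in auto)
  let ?f = "\<lambda>v. lab ! g v"
  have "bij_betw g V {..<length lab}" using inj img lab by (simp add: bij_betw_def)
  then have "bij_betw ?f V (set lab)"
    using bij_betw_trans[OF _ bij_betw_nth[OF lab(2) refl refl]] by (simp add: comp_def)
  moreover have "adj u v = Q (?f u) (?f v)" if uv: "u \<in> V" "v \<in> V" "u \<noteq> v" for u v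
  proof -
    have sub: "known cs v \<subseteq> {x\<in>V. x \<noteq> v \<and> \<not> adj x v}" using linked_nonadj[OF pcs] uv
      by (auto simp: known_def)
    have "st ! g v \<in> set st" "key_of (st ! g v) = key cs v" using g[OF uv(2)] by auto
    then have "card (known cs v) = D" using cards(2)[of "st ! g v"] uv(2) by simp
    \<comment> \<open>No slack is left, so the known non-neighbours are all there are.\<close>
    then have "known cs v = {x\<in>V. x \<noteq> v \<and> \<not> adj x v}" using sub deg[OF uv(2)] finV
      by (intro card_subset_eq) auto
    then have "linked_keys (key cs u) (key cs v) \<longleftrightarrow> \<not> adj u v" using uv by (auto simp: known_def)
    moreover have "g u \<noteq> g v" using inj uv by (auto dest: inj_onD)
    ultimately show ?thesis using Q[of "g u" "g v"] g[OF uv(1)] g[OF uv(2)] by auto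
  qed
  ultimately show ?thesis by blast
qed

end

text \<open>The condition \<open>4 \<le> \<bar>a - b\<bar> \<le> 9\<close> without subtraction.\<close>

definition near13 :: "nat \<Rightarrow> nat \<Rightarrow> bool" where
  "near13 a b \<longleftrightarrow> a + 4 \<le> b \<and> b \<le> a + 9 \<or> b + 4 \<le> a \<and> a \<le> b + 9"

text \<open>The two states in which the search for \<open>n = 13\<close> and \<open>\<bar>I\<bar> = 4\<close>
  ends, and the vertices of \<open>G13\<close> that correspond to their cells in order.\<close>

definition leaf1 where "leaf1 = [Cell 1 0 False [Red, Green, Blue, Green],
  Cell 1 0 True [Green, Blank, Red, Red], Cell 1 0 False [Blue, Blue, Green, Blue],
  Cell 1 0 True [Red, Red, Blank, Green], Cell 1 0 False [Green, Blue, Red, Red],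
  Cell 1 0 False [Blue, Green, Green, Blue], Cell 1 0 False [Red, Red, Blue, Green],
  Cell 1 0 False [Green, Blue, Green, Red], Cell 1 0 False [Blue, Green, Blue, Blue],
  Cell 1 0 True [Red, Red, Red, Blank], Cell 1 0 False [Green, Blue, Green, Blue],
  Cell 1 0 False [Blue, Green, Blue, Green], Cell 1 0 True [Blank, Red, Red, Red]]"

definition leaf2 where "leaf2 = [Cell 1 0 False [Red, Green, Green, Blue],
  Cell 1 0 False [Green, Red, Blue, Green], Cell 1 0 False [Blue, Red, Blue, Green],
  Cell 1 0 False [Red, Blue, Green, Blue], Cell 1 0 False [Green, Green, Blue, Blue],
  Cell 1 0 True [Blue, Blank, Red, Red], Cell 1 0 False [Red, Blue, Green, Red],
  Cell 1 0 False [Green, Green, Blue, Green], Cell 1 0 True [Blue, Red, Red, Blank],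
  Cell 1 0 False [Red, Blue, Red, Red], Cell 1 0 False [Green, Green, Green, Blue],
  Cell 1 0 True [Blue, Red, Blank, Green], Cell 1 0 True [Blank, Blue, Red, Red]]"

definition labels1 :: "nat list" where "labels1 = [0, 5, 9, 2, 6, 10, 1, 7, 11, 3, 8, 12, 4]"

definition labels2 :: "nat list" where "labels2 = [0, 4, 5, 12, 2, 8, 11, 3, 7, 10, 1, 6, 9]"

fun labelled_as :: "cell list \<Rightarrow> nat list \<Rightarrow> bool" where
  "labelled_as (Cell n s i h # st) (a # lab) = (n = 1 \<and> s = 0 \<and>
     list_all (\<lambda>(p, b). linked_keys (i, h) (key_of p) \<longleftrightarrow> \<not> near13 a b) (zip st lab) \<and>
         labelled_as st lab)"
| "labelled_as [] [] = True" | "labelled_as _ _ = False"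

lemma near13_sym: "near13 a b = near13 b a" by (auto simp: near13_def)

lemma labelled_as:
  assumes "labelled_as st lab"
  shows "length lab = length st" "\<forall>p\<in>set st. size_of p = 1 \<and> slack_of p = 0"
    "i < length st \<Longrightarrow> j < length st \<Longrightarrow> i \<noteq> j \<Longrightarrow> linked_keys (key_of (st ! i)) (key_of (st ! j)) \<longleftrightarrow>
        \<not> near13 (lab ! i) (lab ! j)"
  using assms
proof (induction st lab arbitrary: i j rule: labelled_as.induct)
  case (1 n s x h st a lab)
  {
    case 1 then show ?case using "1.IH"(1) by simp
  next
    case 2 then show ?case using "1.IH"(2) by simp
  next
    case 3
    have len: "length lab = length st" using "1.IH"(1) 3(4) by simp
    have z: "linked_keys (x, h) (key_of (st ! k)) \<longleftrightarrow> \<not> near13 a (lab ! k)" if "k < length st" for k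
    proof -
      have "(st ! k, lab ! k) \<in> set (zip st lab)" using that len by (auto simp: in_set_zip)
      then show ?thesis using 3(4) by (auto simp: list_all_iff)
    qed
    show ?case
    proof (cases i)
      case 0
      then obtain k where "j = Suc k" using 3(3) by (cases j) auto
      then show ?thesis using 0 z[of k] 3(2) by simp
    next
      case (Suc i')
      show ?thesis
      proof (cases j)
        case 0
        then show ?thesis using Suc z[of i'] 3(1)
          by (simp add: linked_keys_sym[of "key_of (st ! i')"] near13_sym[of _ a])
      next
        case (Suc j')
        then show ?thesis using \<open>i = Suc i'\<close> "1.IH"(3)[of i' j'] 3 by simp
      qed
    qed
  }
qed auto

lemma leaves_labelled: "labelled_as leaf1 labels1" "labelled_as leaf2 labels2" by code_simp+

lemma labels: "distinct labels1" "distinct labels2" "set labels1 = {0..12}" "set labels2 = {0..12}"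
proof -
  have "set [0..<13] = {0..12::nat}" by auto
  moreover have "sort labels1 = [0..<13]" "sort labels2 = [0..<13]" by code_simp+
  ultimately show "set labels1 = {0..12}" "set labels2 = {0..12}" by (metis set_sort)+
qed (simp_all add: labels1_def labels2_def)

definition final :: "nat \<Rightarrow> nat \<Rightarrow> cell list list" where
  "final n al = (if n = 13 \<and> al = 4 then [leaf1, leaf2] else [])"

section \<open>The searches\<close>

text \<open>Each of these lemmas traverses the search trees for one pair \<open>(n, \<bar>I\<bar>)\<close>, or
  for one concentration where this takes long. The trees for 15 vertices and \<open>\<bar>I\<bar> = 5\<close>
  are by far the largest.\<close>

lemma closes_15_5_low: "list_all (search 15 5 []) [0, 1]" by code_simp

lemma closes_15_5_2: "search 15 5 [] 2" by code_simp

lemma closes_15_5_3: "search 15 5 [] 3" by code_simp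

lemma closes_15_5_4: "search 15 5 [] 4" by code_simp

lemma closes_15_5: "list_all (search 15 5 []) [0..<5]"
  using closes_15_5_low closes_15_5_2 closes_15_5_3 closes_15_5_4
  by (simp add: numeral_eq_Suc)

lemma closes_15_6_low: "list_all (search 15 6 []) [0, 1]" by code_simp

lemma closes_15_6_2: "search 15 6 [] 2" by code_simp

lemma closes_15_6_3: "search 15 6 [] 3" by code_simp

lemma closes_15_6_4: "search 15 6 [] 4" by code_simp

lemma closes_15_6_5: "search 15 6 [] 5" by code_simp

lemma closes_15_6: "list_all (search 15 6 []) [0..<6]"
  using closes_15_6_low closes_15_6_2 closes_15_6_3 closes_15_6_4 closes_15_6_5
  by (simp add: numeral_eq_Suc)

lemma closes_14_5_low: "list_all (search 14 5 []) [0, 1]" by code_simp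

lemma closes_14_5_2: "search 14 5 [] 2" by code_simp

lemma closes_14_5_3: "search 14 5 [] 3" by code_simp

lemma closes_14_5_4: "search 14 5 [] 4" by code_simp

lemma closes_14_5: "list_all (search 14 5 []) [0..<5]"
  using closes_14_5_low closes_14_5_2 closes_14_5_3 closes_14_5_4
  by (simp add: numeral_eq_Suc)

lemma closes_9_3: "list_all (search 9 3 []) [0..<3]" by code_simp

lemma closes_10_3: "list_all (search 10 3 []) [0..<3]" by code_simp

lemma closes_10_4: "list_all (search 10 4 []) [0..<4]" by code_simp

lemma closes_11_4: "list_all (search 11 4 []) [0..<4]" by code_simp

lemma closes_11_5: "list_all (search 11 5 []) [0..<5]" by code_simp

lemma closes_12_4: "list_all (search 12 4 []) [0..<4]" by code_simp

lemma closes_12_5: "list_all (search 12 5 []) [0..<5]" by code_simp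

lemma closes_12_6: "list_all (search 12 6 []) [0..<6]" by code_simp

lemma closes_13_5: "list_all (search 13 5 []) [0..<5]" by code_simp

lemma closes_13_6: "list_all (search 13 6 []) [0..<6]" by code_simp

lemma closes_13_7: "list_all (search 13 7 []) [0..<7]" by code_simp

lemma closes_14_6: "list_all (search 14 6 []) [0..<6]" by code_simp

lemma closes_14_7: "list_all (search 14 7 []) [0..<7]" by code_simp

lemma closes_14_8: "list_all (search 14 8 []) [0..<8]" by code_simp

lemma closes_15_7: "list_all (search 15 7 []) [0..<7]" by code_simp

lemma closes_15_8: "list_all (search 15 8 []) [0..<8]" by code_simp

lemma closes_15_9: "list_all (search 15 9 []) [0..<9]" by code_simp

lemma closes_13_4: "list_all (search 13 4 [leaf1, leaf2]) [0..<4]" by code_simp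

text \<open>The hypotheses are the bounds on \<open>\<bar>I\<bar>\<close> that hold for a 6-regular
  4-vertex-critical graph.\<close>

lemma searches:
  assumes "7 \<le> n" "n \<le> 15" "n \<le> 3 * al + 1" "al + 6 \<le> n" "r < al"
  shows "search n al (final n al) r"
proof -
  have "(n, al) \<in> {(9, 3), (10, 3), (10, 4), (11, 4), (11, 5), (12, 4), (12, 5), (12, 6), (13, 4),
    (13, 5), (13, 6), (13, 7), (14, 5), (14, 6), (14, 7), (14, 8), (15, 5), (15, 6), (15, 7), (15, 8),
    (15, 9)}"
    using assms(1-4) by (simp; presburger)
  then have "list_all (search n al (final n al)) [0..<al]"
    using closes_9_3 closes_10_3 closes_10_4 closes_11_4 closes_11_5 closes_12_4 closes_12_5 closes_12_6
      closes_13_4 closes_13_5 closes_13_6 closes_13_7 closes_14_5 closes_14_6 closes_14_7 closes_14_8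
      closes_15_5 closes_15_6 closes_15_7 closes_15_8 closes_15_9
    by (auto simp: final_def simp del: upt_rec_numeral)
  then show ?thesis using assms(5) by (simp add: list_all_iff)
qed

section \<open>Colourings, degrees and chromatic numbers\<close>

lemma chromatic_le: "proper_colouring G k c \<Longrightarrow> chromatic_number G \<le> k"
  unfolding chromatic_number_def by (rule Least_le) blast

text \<open>Numbering the vertices is a proper colouring, so the minimum that defines the chromatic number is
  attained. Without loops this holds for every finite graph.\<close>

lemma chromatic_colouring:
  assumes "finite (verts G)" "\<And>v. {v} \<notin> edges G"
  shows "\<exists>c. proper_colouring G (chromatic_number G) c"
proof -
  obtain f where f: "bij_betw f (verts G) {0..<card (verts G)}"
    using ex_bij_betw_finite_nat[OF assms(1)] by blast
  have "proper_colouring G (card (verts G)) f"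
    unfolding proper_colouring_def
  proof (intro conjI ballI impI)
    fix v assume "v \<in> verts G" then show "f v < card (verts G)" using f by (auto simp: bij_betw_def)
  next
    fix u v assume "u \<in> verts G" "v \<in> verts G" "{u, v} \<in> edges G"
    then show "f u \<noteq> f v" using f assms(2)[of u] by (auto simp: bij_betw_def dest: inj_onD)
  qed
  then show ?thesis unfolding chromatic_number_def
    by (intro LeastI[where P = "\<lambda>k. \<exists>c. proper_colouring G k c"]) blast
qed

lemma proper_colouring_mono: "proper_colouring G k c \<Longrightarrow> k \<le> l \<Longrightarrow> proper_colouring G l c"
  by (auto simp: proper_colouring_def)

lemma chromatic_le_iff:
  assumes "finite (verts G)" "\<And>v. {v} \<notin> edges G"
  shows "chromatic_number G \<le> k \<longleftrightarrow> (\<exists>c. proper_colouring G k c)"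
  using chromatic_le chromatic_colouring[OF assms] proper_colouring_mono by metis

lemma simple_graphD:
  assumes "simple_graph G"
  shows "finite (verts G)" "{v} \<notin> edges G" "{u, v} \<in> edges G \<Longrightarrow> u \<in> verts G \<and> v \<in> verts G \<and> u \<noteq> v"
proof -
  show "finite (verts G)" using assms by (simp add: simple_graph_def)
  have *: "\<exists>x y. e = {x, y} \<and> x \<in> verts G \<and> y \<in> verts G \<and> x \<noteq> y" if "e \<in> edges G" for e
    using assms that by (auto simp: simple_graph_def)
  show "{v} \<notin> edges G" using *[of "{v}"] by (auto simp: doubleton_eq_iff)
  show "{u, v} \<in> edges G \<Longrightarrow> u \<in> verts G \<and> v \<in> verts G \<and> u \<noteq> v" using *[of "{u, v}"]
    by (auto simp: doubleton_eq_iff)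
qed

text \<open>In a simple graph an edge at \<open>v\<close> is given by its other end.\<close>

lemma degree_eq:
  assumes "simple_graph G"
  shows "degree G v = card {u\<in>verts G. {u, v} \<in> edges G}"
proof -
  have "{e\<in>edges G. v \<in> e} = (\<lambda>u. {u, v}) ` {u\<in>verts G. {u, v} \<in> edges G}"
  proof (intro equalityI subsetI)
    fix e assume e: "e \<in> {e\<in>edges G. v \<in> e}"
    then obtain x y where "e = {x, y}" "x \<in> verts G" "y \<in> verts G" using assms
      by (auto simp: simple_graph_def)
    then show "e \<in> (\<lambda>u. {u, v}) ` {u\<in>verts G. {u, v} \<in> edges G}" using e by (auto simp: insert_commute)
  qed auto
  moreover have "inj_on (\<lambda>u. {u, v}) A" for A by (auto simp: inj_on_def doubleton_eq_iff)
  ultimately show ?thesis unfolding degree_def by (simp add: card_image)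
qed

section \<open>Critical graphs with at most 15 vertices\<close>

definition to_colour :: "nat \<Rightarrow> colour" where
  "to_colour k = (if k = 0 then Red else if k = 1 then Green else Blue)"

definition of_colour :: "colour \<Rightarrow> nat" where
  "of_colour c = (case c of Blank \<Rightarrow> 0 | Red \<Rightarrow> 0 | Green \<Rightarrow> 1 | Blue \<Rightarrow> 2)"

text \<open>Any largest independent set can serve as \<open>I\<close>. It remains to see that the pair
  \<open>(n, \<bar>I\<bar>)\<close> is among those searched; the search then leaves only the states
  \<open>leaf1\<close> and \<open>leaf2\<close>, which determine the graph.\<close>

theorem small_critical_graph:
  fixes G :: "'a ugraph"
  assumes G: "simple_graph G" "regular 6 G" "vertex_critical 4 G" and n15: "card (verts G) \<le> 15"
  shows "\<exists>f. bij_betw f (verts G) {0..12} \<and>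
      (\<forall>u\<in>verts G. \<forall>v\<in>verts G. {u, v} \<in> edges G \<longleftrightarrow> near13 (f u) (f v))"
proof -
  let ?V = "verts G" let ?n = "card ?V" let ?adj = "\<lambda>u v. {u, v} \<in> edges G"
  note sg = simple_graphD[OF G(1)]
  define indep where "indep S \<longleftrightarrow> S \<subseteq> ?V \<and> (\<forall>u\<in>S. \<forall>v\<in>S. \<not> ?adj u v)" for S
  have fin: "finite {S. indep S}" using sg(1)
    by (rule_tac finite_subset[of _ "Pow ?V"]) (auto simp: indep_def)
  have "indep {}" by (simp add: indep_def)
  then have "card ` {S. indep S} \<noteq> {}" by auto
  then obtain I where I: "indep I" "card I = Max (card ` {S. indep S})"
    using Max_in[of "card ` {S. indep S}"] fin
      by (metis (mono_tags, lifting) finite_imageI imageE mem_Collect_eq)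
  have max: "card S \<le> card I" if "indep S" for S using that fin I(2) by simp
  have chi: "chromatic_number G = 4" using G(3) by (simp add: vertex_critical_def)
  have "?V \<noteq> {}"
  proof
    assume "?V = {}"
    then have "proper_colouring G 0 (\<lambda>_. 0)" by (simp add: proper_colouring_def)
    then show False using chromatic_le chi by fastforce
  qed
  then obtain v0 where v0: "v0 \<in> ?V" by auto
  have nbrs: "card {u\<in>?V. ?adj u v} = 6" if "v \<in> ?V" for v
    using G(2) degree_eq[OF G(1)] that by (simp add: regular_def)
  have deg: "card {u\<in>?V. u \<noteq> v \<and> \<not> ?adj u v} = ?n - 7" if v: "v \<in> ?V" for v
  proof -
    have "{u\<in>?V. u \<noteq> v \<and> \<not> ?adj u v} = ?V - insert v {u\<in>?V. ?adj u v}" using sg by auto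
    moreover have "card (insert v {u\<in>?V. ?adj u v}) = 7" using nbrs[OF v] sg by simp
    ultimately show ?thesis using v sg(1) by (simp add: card_Diff_subset)
  qed
  have "indep {v0}" using v0 sg(2)[of v0] by (auto simp: indep_def)
  then have "0 < card I" using max by fastforce
  then obtain a where a: "a \<in> I" by (metis card.empty equals0I less_irrefl)
  have IV: "I \<subseteq> ?V" and finite_I: "finite I" using I(1) sg(1) finite_subset by (auto simp: indep_def)
  \<comment> \<open>The six neighbours of \<open>a\<close> lie outside \<open>I\<close>.\<close>
  have al6: "card I + 6 \<le> ?n"
  proof -
    have "{u\<in>?V. ?adj u a} \<subseteq> ?V - I" using I(1) a by (auto simp: indep_def)
    then have "6 \<le> card (?V - I)" using nbrs[of a] a IV sg(1) card_mono[of "?V - I"]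
      by (metis finite_Diff subsetD)
    then show ?thesis using card_Diff_subset[OF finite_I IV] by simp
  qed
  interpret critical_config ?V ?adj I "?n - 7" "card I"
  proof
    show "card S \<le> card I" if "S \<subseteq> ?V" "\<And>u v. u \<in> S \<Longrightarrow> v \<in> S \<Longrightarrow> u \<noteq> v \<Longrightarrow> \<not> ?adj u v" for S
      using that sg(2) by (intro max) (auto simp: indep_def, metis insert_absorb2)
  qed (use sg I IV deg in \<open>auto simp: insert_commute indep_def\<close>)
  interpret critical4 ?V ?adj I "?n - 7" "card I"
  proof
    show "\<not> (\<exists>c. partial c \<and> (\<forall>v\<in>?V. c v \<noteq> Blank))"
    proof
      assume "\<exists>c. partial c \<and> (\<forall>v\<in>?V. c v \<noteq> Blank)"
      then obtain c where c: "partial c" "\<forall>v\<in>?V. c v \<noteq> Blank" by blast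
      have "proper_colouring G 3 (\<lambda>v. of_colour (c v))" unfolding proper_colouring_def
      proof (intro conjI ballI impI)
        fix u v assume uv: "u \<in> ?V" "v \<in> ?V" "?adj u v"
        then have "u \<noteq> v" using sg by blast
        then have "c u \<noteq> c v" using c uv by (auto simp: partial_def)
        then show "of_colour (c u) \<noteq> of_colour (c v)" using c(2) uv
          by (auto simp: of_colour_def split: colour.splits)
      qed (auto simp: of_colour_def split: colour.splits)
      then show False using chromatic_le chi by fastforce
    qed
    fix w assume w: "w \<in> ?V"
    let ?H = "del_vertex G w"
    have "chromatic_number ?H \<le> 3" using G(3) w by (simp add: vertex_critical_def)
    then obtain c where c: "proper_colouring ?H 3 c"
      using chromatic_le_iff[of ?H 3] sg by (auto simp: del_vertex_def)
    have "punctured w (\<lambda>v. if v = w then Blank else to_colour (c v))"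
      unfolding punctured_def partial_def
    proof (intro conjI ballI impI)
      fix u v assume uv: "u \<in> ?V" "v \<in> ?V" "u \<noteq> v"
        "(if u = w then Blank else to_colour (c u)) = (if v = w then Blank else to_colour (c v))"
        "(if u = w then Blank else to_colour (c u)) \<noteq> Blank"
      then have ne: "u \<noteq> w" "v \<noteq> w" by (auto simp: to_colour_def split: if_splits)
      then have lt: "c u < 3" "c v < 3" and eq: "to_colour (c u) = to_colour (c v)" using c uv
        by (auto simp: proper_colouring_def del_vertex_def)
      then have "c u = c v" by (auto simp: to_colour_def split: if_splits)
      then show "\<not> ?adj u v" using c uv ne by (auto simp: proper_colouring_def del_vertex_def)
    qed (auto simp: to_colour_def)
    then show "\<exists>c. punctured w c" by blast
  qed
  \<comment> \<open>All vertices but \<open>v0\<close> lie in three independent sets.\<close>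
  have al3: "?n \<le> 3 * card I + 1"
  proof -
    obtain c where c: "punctured v0 c" using crit[OF v0] by blast
    have le: "card {v\<in>?V. c v = k} \<le> card I" if "k \<noteq> Blank" for k
      using c that by (intro alpha) (auto simp: punctured_def partial_def)
    have "?V \<subseteq> {v0} \<union> ({v\<in>?V. c v = Red} \<union> ({v\<in>?V. c v = Green} \<union> {v\<in>?V. c v = Blue}))"
      using c by (auto simp: punctured_def) (metis colour.exhaust)
    then have "?n \<le> card ({v0} \<union> ({v\<in>?V. c v = Red} \<union> ({v\<in>?V. c v = Green} \<union> {v\<in>?V. c v = Blue})))"
      using sg(1) by (intro card_mono) auto
    also have "\<dots> \<le> 1 + (card I + (card I + card I))"
      by (intro order_trans[OF card_Un_le] add_mono le) auto
    finally show ?thesis by simp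
  qed
  have n7: "7 \<le> ?n" using al6 \<open>0 < card I\<close> by simp
  obtain cs st where st: "st \<in> set (final ?n (card I))" "represents cs st"
    using search_correct[OF \<open>0 < card I\<close> refl refl _ searches[OF n7 n15 al3 al6]] al6 by force
  have "\<exists>f. bij_betw f ?V {0..12} \<and> (\<forall>u\<in>?V. \<forall>v\<in>?V. u \<noteq> v \<longrightarrow> ?adj u v = near13 (f u) (f v))"
  proof -
    have "st = leaf1 \<or> st = leaf2" using st(1) by (auto simp: final_def split: if_splits)
    then obtain lab where lab: "labelled_as st lab" "distinct lab" "set lab = {0..12}"
      using leaves_labelled labels by metis
    show ?thesis
      using leaf_determines_graph[OF st(2) labelled_as(2)[OF lab(1)] labelled_as(1)[OF lab(1)]
        lab(2) labelled_as(3)[OF lab(1)]]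
      unfolding lab(3) .
  qed
  then obtain f where f: "bij_betw f ?V {0..12}" "\<forall>u\<in>?V. \<forall>v\<in>?V. u \<noteq> v \<longrightarrow> ?adj u v = near13 (f u) (f v)"
    by blast
  have "?adj u v = near13 (f u) (f v)" if "u \<in> ?V" "v \<in> ?V" for u v
  proof (cases "u = v")
    case True then show ?thesis using sg(2)[of u] by (simp add: near13_def)
  next
    case False then show ?thesis using f(2) that by blast
  qed
  then show ?thesis using f(1) by blast
qed

section \<open>The graph on 13 vertices\<close>

lemma edges_G13: "{i, j} \<in> edges G13 \<longleftrightarrow> i \<le> 12 \<and> j \<le> 12 \<and> near13 i j"
proof -
  have *: "4 \<le> \<bar>int i - int j\<bar> \<and> \<bar>int i - int j\<bar> \<le> 9 \<longleftrightarrow> near13 i j" for i j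
    unfolding near13_def by linarith
  show ?thesis
    unfolding G13_def ugraph.simps * by (auto simp: doubleton_eq_iff near13_sym)
qed

lemma verts_G13: "verts G13 = {0..12}" by (simp add: G13_def)

lemma simple_G13: "simple_graph G13"
proof -
  have "edges G13 \<subseteq> {{u, v} |u v. u \<in> verts G13 \<and> v \<in> verts G13 \<and> u \<noteq> v}"
    unfolding G13_def by fastforce
  then show ?thesis by (simp add: simple_graph_def verts_G13)
qed

lemma regular_G13: "regular 6 G13"
  unfolding regular_def
proof
  fix v assume v: "v \<in> verts G13"
  have "list_all (\<lambda>v. length (filter (\<lambda>u. near13 u v) [0..<13]) = 6) [0..<13]" by code_simp
  then have "length (filter (\<lambda>u. near13 u v) [0..<13]) = 6" using v
    by (auto simp: list_all_iff verts_G13)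
  then have "card (set (filter (\<lambda>u. near13 u v) [0..<13])) = 6"
    by (simp only: distinct_card distinct_filter distinct_upt)
  also have "set (filter (\<lambda>u. near13 u v) [0..<13]) = {u\<in>verts G13. {u, v} \<in> edges G13}"
    using v by (auto simp: edges_G13 verts_G13)
  finally show "degree G13 v = 6" by (simp add: degree_eq[OF simple_G13])
qed

definition step :: "nat \<Rightarrow> nat" where
  "step s = (if s < 9 then s + 4 else s - 9)"

text \<open>Rotations preserve the graph, and \<open>turn s\<close> is the one that takes \<open>s\<close> to
  0.\<close>

definition turn :: "nat \<Rightarrow> nat \<Rightarrow> nat" where
  "turn s u = (if s \<le> u then u - s else u + 13 - s)"

text \<open>\<open>arc s\<close> is the colouring that starts the arc of 5 vertices at \<open>s\<close> and lets
  those of 4 follow.\<close>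

definition arc :: "nat \<Rightarrow> nat \<Rightarrow> nat" where
  "arc s u = (if turn s u < 5 then 0 else if turn s u < 9 then 1 else 2)"

lemma arc_less: "arc s u < 3" by (simp add: arc_def)

lemma near13_turn: "s \<le> 12 \<Longrightarrow> u \<le> 12 \<Longrightarrow> v \<le> 12 \<Longrightarrow> near13 u v \<Longrightarrow> near13 (turn s u) (turn s v)"
  unfolding near13_def turn_def by (cases "s \<le> u"; cases "s \<le> v") auto

lemma turn_0: "s \<le> 12 \<Longrightarrow> u \<le> 12 \<Longrightarrow> turn s u = 0 \<Longrightarrow> u = s"
  unfolding turn_def by (auto split: if_splits)

lemma turn_4: "s \<le> 12 \<Longrightarrow> u \<le> 12 \<Longrightarrow> turn s u = 4 \<Longrightarrow> u = step s"
  unfolding turn_def step_def by (auto split: if_splits)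

text \<open>Vertices in an arc of 4 have distance at most 3, and in the arc of 5 only the two ends reach
  distance 4.\<close>

lemma arc_near:
  assumes s: "s \<le> 12" and uv: "u \<le> 12" "v \<le> 12" "near13 u v" and eq: "arc s u = arc s v"
  shows "{u, v} = {s, step s}"
proof -
  have le: "turn s u \<le> 12" "turn s v \<le> 12" using s uv by (auto simp: turn_def)
  have "near13 (turn s u) (turn s v)" by (rule near13_turn) (fact s uv)+
  then have "turn s u = 0 \<and> turn s v = 4 \<or> turn s u = 4 \<and> turn s v = 0"
    using eq le unfolding arc_def near13_def
      by (cases "turn s u < 5"; cases "turn s v < 5"; cases "turn s u < 9"; cases "turn s v < 9") auto
  then show ?thesis using turn_0[OF s] turn_4[OF s] uv by auto
qed

fun clash :: "('a \<Rightarrow> 'a \<Rightarrow> bool) \<Rightarrow> 'a \<Rightarrow> ('a \<times> nat) list \<Rightarrow> nat \<Rightarrow> bool" where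
  "clash Q v [] k = False"
| "clash Q v ((u, l) # us) k = (if k = l then Q u v \<or> clash Q v us k else clash Q v us k)"

text \<open>Colours the vertices in the given order and backtracks: \<open>stuck Q vs us\<close> holds if no
  choice of colours for \<open>vs\<close> extends the assignment \<open>us\<close> without a clash.\<close>

fun stuck :: "('a \<Rightarrow> 'a \<Rightarrow> bool) \<Rightarrow> 'a list \<Rightarrow> ('a \<times> nat) list \<Rightarrow> bool" where
  "stuck Q [] us = False"
| "stuck Q (v # vs) us = list_all (\<lambda>k. if clash Q v us k then True
  else stuck Q vs ((v, k) # us)) [0, 1, 2]"

lemma clash_iff: "clash Q v us k \<longleftrightarrow> (\<exists>u. (u, k) \<in> set us \<and> Q u v)"
  by (induction Q v us k rule: clash.induct) auto

lemma stuck_not_colourable: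
  assumes "stuck Q vs us" "\<forall>(u, l)\<in>set us. c u = l" "\<forall>v\<in>set vs. c v < 3"
  shows "\<exists>u\<in>set vs \<union> fst ` set us. \<exists>v\<in>set vs. Q u v \<and> c u = c v"
  using assms
proof (induction Q vs us rule: stuck.induct)
  case (2 Q v vs us)
  have "c v \<in> set [0, 1, 2]" using 2(4) by auto
  show ?case
  proof (cases "clash Q v us (c v)")
    case True
    then obtain u where "(u, c v) \<in> set us" "Q u v" by (auto simp: clash_iff)
    then show ?thesis using 2(3) by force
  next
    case False
    then have "stuck Q vs ((v, c v) # us)" using 2(2) \<open>c v \<in> set [0, 1, 2]\<close> by (auto simp: list_all_iff)
    then have "\<exists>x\<in>set vs \<union> fst ` set ((v, c v) # us). \<exists>y\<in>set vs. Q x y \<and> c x = c y"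
      using 2(1)[OF \<open>c v \<in> set [0, 1, 2]\<close> False] 2(3,4) by auto
    then show ?thesis by auto
  qed
qed simp

text \<open>In steps of 4 each vertex is adjacent to the two preceding ones, so that with few exceptions its
  colour is forced when the vertices are coloured in this order. The same order traverses the Hamilton
  cycle.\<close>

definition round13 :: "nat list" where "round13 = [0, 4, 8, 12, 3, 7, 11, 2, 6, 10, 1, 5, 9]"

definition without :: "nat \<Rightarrow> nat \<Rightarrow> nat \<Rightarrow> nat \<Rightarrow> bool" where
  "without a b u v = (if near13 u v then {u, v} \<noteq> {a, b} else False)"

lemma without_code [code]:
  "without a b u v = (if near13 u v then if u = a then v \<noteq> b else if u = b then v \<noteq> a else True
      else False)"
  by (auto simp: without_def doubleton_eq_iff near13_def)

text \<open>The pairs \<open>a < b\<close> with \<open>5 \<le> b - a \<le> 8\<close> are the edges of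
  \<open>G13\<close> at distance 5 or 6 on the cycle.\<close>

lemma long_edges_stuck:
  "list_all (\<lambda>a. list_all (\<lambda>b. stuck (without a b) round13 []) [a + 5..<min 13 (a + 9)]) [0..<8]"
  by code_simp

lemma set_round13: "set round13 = {0..12}" "distinct round13" "length round13 = 13"
proof -
  have "set [0..<13] = {0..12::nat}" by auto
  moreover have "sort round13 = [0..<13]" by code_simp
  ultimately show "set round13 = {0..12}" by (metis set_sort)
qed (simp_all add: round13_def)

lemma short_edge_cases: "near13 a b \<Longrightarrow> a \<le> 12 \<Longrightarrow> b \<le> 12 \<Longrightarrow> a < b \<Longrightarrow> b \<noteq> a + 4 \<Longrightarrow> b \<noteq> a + 9 \<Longrightarrow> a + 5 \<le> b \<and>
  b < a + 9 \<and> a < 8"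
  by (auto simp: near13_def)

lemma uncolourable_without:
  assumes ab: "a + 5 \<le> b" "b < a + 9" "b \<le> 12" and c: "\<forall>v\<le>12. c v < (3::nat)"
  shows "\<exists>u\<le>12. \<exists>v\<le>12. near13 u v \<and> {u, v} \<noteq> {a, b} \<and> c u = c v"
proof -
  have "a \<in> set [0..<8]" "b \<in> set [a + 5..<min 13 (a + 9)]" using ab by auto
  then have "stuck (without a b) round13 []" using long_edges_stuck unfolding list_all_iff by blast
  then obtain u v where uv: "u \<in> {0..12}" "v \<in> {0..12}" "without a b u v" "c u = c v"
    using stuck_not_colourable[of "without a b" round13 "[]" c] c unfolding set_round13 by auto
  then have "near13 u v \<and> {u, v} \<noteq> {a, b}" unfolding without_def by meson
  then show ?thesis using uv by auto
qed

lemma not_3_colourable_without: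
  assumes "e \<in> edges G13" "e \<notin> (\<lambda>s. {s, step s}) ` {0..12}"
  shows "\<not> proper_colouring (del_edge G13 e) 3 c"
proof
  assume c: "proper_colouring (del_edge G13 e) 3 c"
  have *: "\<exists>a b. e = {a, b} \<and> a < b \<and> b \<le> 12 \<and> near13 a b"
  proof -
    obtain a b where ab: "e = {a, b}" using assms(1) by (auto simp: G13_def)
    then have n: "near13 a b" "a \<le> 12" "b \<le> 12" using assms(1) edges_G13 by auto
    show ?thesis
    proof (cases "a < b")
      case False
      then have "b < a" using n(1) by (auto simp: near13_def)
      then show ?thesis using ab n near13_sym[of a b] by (metis insert_commute)
    qed (use ab n in blast)
  qed
  then obtain a b where ab: "e = {a, b}" "a < b" "b \<le> 12" "near13 a b" by blast
  have "b \<noteq> a + 4"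
  proof
    assume "b = a + 4"
    then have "e = {a, step a}" using ab by (simp add: step_def)
    then show False using assms(2) ab by (meson atLeastAtMost_iff image_eqI le0 less_imp_le order_trans)
  qed
  moreover have "b \<noteq> a + 9"
  proof
    assume "b = a + 9"
    then have "e = {b, step b}" using ab by (auto simp: step_def)
    then show False using assms(2) ab by (meson atLeastAtMost_iff image_eqI le0)
  qed
  ultimately have "a + 5 \<le> b" "b < a + 9" using short_edge_cases[OF ab(4) _ ab(3) ab(2)] ab by auto
  moreover have "\<forall>v\<le>12. c v < 3" using c by (auto simp: proper_colouring_def del_edge_def verts_G13)
  ultimately obtain u v where "u \<le> 12" "v \<le> 12" "near13 u v" "{u, v} \<noteq> e" "c u = c v"
    using uncolourable_without[of a b c] ab(1,3) by blast
  then show False using c by (auto simp: proper_colouring_def del_edge_def verts_G13 edges_G13)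
qed

lemma not_3_colourable_G13: "\<not> proper_colouring G13 3 c"
proof
  assume "proper_colouring G13 3 c"
  then have "proper_colouring (del_edge G13 {0, 5}) 3 c"
    by (auto simp: proper_colouring_def del_edge_def)
  moreover have "{0, 5} \<in> edges G13" by (simp add: edges_G13 near13_def)
  moreover have "{0, 5} \<notin> (\<lambda>s. {s, step s}) ` {0..12}" by (auto simp: step_def doubleton_eq_iff)
  ultimately show False using not_3_colourable_without by blast
qed

lemma chromatic_G13: "chromatic_number G13 = 4"
proof -
  note iff = chromatic_le_iff[OF simple_graphD(1,2)[OF simple_G13]]
  have "proper_colouring G13 4 (\<lambda>u. u div 4)"
    unfolding proper_colouring_def verts_G13 edges_G13 near13_def by auto
  then have "chromatic_number G13 \<le> 4" by (rule chromatic_le)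
  moreover have "\<not> chromatic_number G13 \<le> 3" using iff not_3_colourable_G13 by blast
  ultimately show ?thesis by simp
qed

lemma arc_colours_without:
  assumes "s \<le> 12"
  shows "proper_colouring (del_edge G13 {s, step s}) 3 (arc s)"
  unfolding proper_colouring_def
proof (intro conjI ballI impI notI)
  fix u v assume uv: "{u, v} \<in> edges (del_edge G13 {s, step s})" "arc s u = arc s v"
  then have "{u, v} \<in> edges G13" "{u, v} \<noteq> {s, step s}" by (simp_all add: del_edge_def)
  then show False using arc_near[OF assms _ _ _ uv(2)] by (simp add: edges_G13)
qed (rule arc_less)

text \<open>The arcs starting at \<open>v\<close> clash only in an edge at \<open>v\<close>, so that they colour
  the graph without \<open>v\<close>. Conversely a 2-colouring without \<open>v\<close> would give a 3-colouring
  of the whole graph.\<close>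

lemma vertex_critical_G13: "vertex_critical 4 G13"
proof -
  have "chromatic_number (del_vertex G13 v) = 3" if v: "v \<in> verts G13" for v
  proof -
    have "proper_colouring (del_vertex G13 v) 3 (arc v)"
      unfolding proper_colouring_def
    proof (intro conjI ballI impI notI)
      fix x y assume xy: "{x, y} \<in> edges (del_vertex G13 v)" "arc v x = arc v y"
      then have "{x, y} \<in> edges G13" "v \<notin> {x, y}" by (simp_all add: del_vertex_def)
      moreover from this have "{x, y} = {v, step v}"
        using v xy(2) by (intro arc_near) (auto simp: edges_G13 verts_G13)
      ultimately show False by simp
    qed (rule arc_less)
    then have "chromatic_number (del_vertex G13 v) \<le> 3" by (rule chromatic_le)
    moreover have "\<not> chromatic_number (del_vertex G13 v) \<le> 2"
    proof
      assume "chromatic_number (del_vertex G13 v) \<le> 2"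
      then obtain c where c: "proper_colouring (del_vertex G13 v) 2 c"
        using chromatic_le_iff[of "del_vertex G13 v" 2] simple_graphD(1,2)[OF simple_G13]
          by (auto simp: del_vertex_def)
      have "proper_colouring G13 3 (c(v := 2))"
        unfolding proper_colouring_def
      proof (intro conjI ballI impI)
        fix x assume "x \<in> verts G13"
        then have "x \<noteq> v \<Longrightarrow> c x < 2" using c by (simp add: proper_colouring_def del_vertex_def)
        then show "(c(v := 2)) x < 3" by (cases "x = v") auto
      next
        fix x y assume xy: "x \<in> verts G13" "y \<in> verts G13" "{x, y} \<in> edges G13"
        then have "x \<noteq> y" using simple_graphD[OF simple_G13] by blast
        show "(c(v := 2)) x \<noteq> (c(v := 2)) y"
        proof -
          have "c x \<noteq> c y" if "x \<noteq> v" "y \<noteq> v" using c xy that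
            by (simp add: proper_colouring_def del_vertex_def)
          moreover have "c z < 2" if "z \<in> verts G13" "z \<noteq> v" for z using c that
            by (simp add: proper_colouring_def del_vertex_def)
          then have "x \<noteq> v \<Longrightarrow> c x \<noteq> 2" "y \<noteq> v \<Longrightarrow> c y \<noteq> 2" using xy by fastforce+
          ultimately show ?thesis using \<open>x \<noteq> y\<close> by auto
        qed
      qed
      then show False using not_3_colourable_G13 by blast
    qed
    ultimately show ?thesis by simp
  qed
  then show ?thesis by (simp add: vertex_critical_def chromatic_G13)
qed

lemma critical_edges_G13: "critical_edges G13 = (\<lambda>s. {s, step s}) ` {0..12}"
proof (intro equalityI subsetI)
  fix e assume "e \<in> critical_edges G13"
  then have e: "e \<in> edges G13" "chromatic_number (del_edge G13 e) \<le> 3"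
    by (auto simp: critical_edges_def chromatic_G13)
  then obtain c where "proper_colouring (del_edge G13 e) 3 c"
    using chromatic_le_iff[of "del_edge G13 e" 3] simple_graphD(1,2)[OF simple_G13]
      by (auto simp: del_edge_def)
  then show "e \<in> (\<lambda>s. {s, step s}) ` {0..12}" using not_3_colourable_without[OF e(1)] by blast
next
  fix e assume "e \<in> (\<lambda>s. {s, step s}) ` {0..12}"
  then obtain s where s: "s \<le> 12" "e = {s, step s}" by auto
  have "e \<in> edges G13" using s by (auto simp: edges_G13 near13_def step_def)
  moreover have "chromatic_number (del_edge G13 e) \<le> 3"
    using chromatic_le[OF arc_colours_without[OF s(1)]] s(2) by simp
  ultimately show "e \<in> critical_edges G13" by (simp add: critical_edges_def chromatic_G13)
qed

lemma card_critical_edges_G13: "card (critical_edges G13) = 13"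
proof -
  have "inj_on (\<lambda>s. {s, step s}) {0..12}"
    by (rule inj_onI) (auto simp: doubleton_eq_iff step_def split: if_splits)
  then show ?thesis by (simp add: critical_edges_G13 card_image)
qed

text \<open>Since 4 is prime to 13, the steps of 4 pass through all vertices.\<close>

lemma hamilton_cycle_G13: "hamilton_cycle G13 (critical_edges G13)"
proof -
  have "list_all (\<lambda>i. round13 ! (Suc i mod 13) = step (round13 ! i)) [0..<13]" by code_simp
  then have *: "round13 ! (Suc i mod 13) = step (round13 ! i)" if "i < 13" for i using that
    by (simp add: list_all_iff)
  have "critical_edges G13 = {{round13 ! i, step (round13 ! i)} |i. i < 13}"
    unfolding critical_edges_G13 set_round13(1)[symmetric] by (auto simp: set_conv_nth set_round13(3))
  also have "\<dots> = {{round13 ! i, round13 ! (Suc i mod length round13)} |i. i < length round13}"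
    unfolding set_round13(3) using * by (intro Collect_cong ex_cong1) auto
  finally have "critical_edges G13 = {{round13 ! i, round13 ! (Suc i mod length round13)} |i. i < length
    round13}" .
  moreover have "critical_edges G13 \<subseteq> edges G13" by (auto simp: critical_edges_def)
  ultimately show ?thesis unfolding hamilton_cycle_def
    using set_round13 by (intro conjI exI[of _ round13]) (simp_all add: verts_G13)
qed

section \<open>Isomorphism with the graph on 13 vertices\<close>

lemma isomorphic_via_G13:
  assumes "isomorphic G G13" "isomorphic H G13"
  shows "isomorphic G H"
proof -
  obtain f where f: "bij_betw f (verts G) (verts G13)"
    "\<forall>u\<in>verts G. \<forall>v\<in>verts G. {u, v} \<in> edges G \<longleftrightarrow> {f u, f v} \<in> edges G13"
    using assms(1) unfolding isomorphic_def by blast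
  obtain g where g: "bij_betw g (verts H) (verts G13)"
    "\<forall>u\<in>verts H. \<forall>v\<in>verts H. {u, v} \<in> edges H \<longleftrightarrow> {g u, g v} \<in> edges G13"
    using assms(2) unfolding isomorphic_def by blast
  let ?h = "inv_into (verts H) g"
  have h: "bij_betw ?h (verts G13) (verts H)" using g(1) by (rule bij_betw_inv_into)
  have "{u, v} \<in> edges G \<longleftrightarrow> {?h (f u), ?h (f v)} \<in> edges H" if uv: "u \<in> verts G" "v \<in> verts G" for u v
  proof -
    have fu: "f u \<in> verts G13" "f v \<in> verts G13" using f(1) uv by (auto simp: bij_betw_def)
    then have "?h (f u) \<in> verts H" "?h (f v) \<in> verts H" using h by (auto simp: bij_betw_def)
    then have "{?h (f u), ?h (f v)} \<in> edges H \<longleftrightarrow> {g (?h (f u)), g (?h (f v))} \<in> edges G13" using g(2)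
      by blast
    also have "\<dots> \<longleftrightarrow> {f u, f v} \<in> edges G13" using bij_betw_inv_into_right[OF g(1)] fu by simp
    also have "\<dots> \<longleftrightarrow> {u, v} \<in> edges G" using f(2) uv by blast
    finally show ?thesis by simp
  qed
  moreover have "bij_betw (?h \<circ> f) (verts G) (verts H)" using f(1) h by (rule bij_betw_trans)
  ultimately show ?thesis unfolding isomorphic_def by (intro exI[of _ "?h \<circ> f"]) simp
qed

lemma small_critical_isomorphic:
  assumes "simple_graph G" "regular 6 G" "vertex_critical 4 G" "card (verts G) \<le> 15"
  shows "isomorphic G G13"
proof -
  obtain f where f: "bij_betw f (verts G) {0..12}"
    "\<forall>u\<in>verts G. \<forall>v\<in>verts G. {u, v} \<in> edges G \<longleftrightarrow> near13 (f u) (f v)"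
    using small_critical_graph[OF assms] by blast
  have "f v \<le> 12" if "v \<in> verts G" for v using f(1) that by (auto simp: bij_betw_def)
  then show ?thesis unfolding isomorphic_def verts_G13 edges_G13 using f by blast
qed

lemma isomorphic_card: "isomorphic G G13 \<Longrightarrow> card (verts G) = 13"
  unfolding isomorphic_def verts_G13 by (auto dest: bij_betw_same_card)

text \<open>The edge that corresponds to \<open>{0, 4}\<close> is critical: the arcs starting at 0, pulled back
  along the isomorphism, colour the rest.\<close>

lemma isomorphic_G13_critical_edge:
  assumes G: "simple_graph G" and iso: "isomorphic G G13"
  shows "\<exists>e\<in>edges G. chromatic_number (del_edge G e) \<le> 3"
proof -
  obtain f where f: "bij_betw f (verts G) {0..12}"
    "\<forall>u\<in>verts G. \<forall>v\<in>verts G. {u, v} \<in> edges G \<longleftrightarrow> {f u, f v} \<in> edges G13"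
    using iso unfolding isomorphic_def verts_G13 by blast
  have "0 \<in> f ` verts G" "4 \<in> f ` verts G" using f(1) by (auto simp: bij_betw_def)
  then obtain a b where ab: "a \<in> verts G" "f a = 0" "b \<in> verts G" "f b = 4" by force
  have "{a, b} \<in> edges G" using f(2) ab by (auto simp: edges_G13 near13_def)
  moreover have "proper_colouring (del_edge G {a, b}) 3 (\<lambda>v. arc 0 (f v))"
    unfolding proper_colouring_def
  proof (intro conjI ballI impI)
    fix u v assume uv: "u \<in> verts (del_edge G {a, b})" "v \<in> verts (del_edge G {a, b})"
      "{u, v} \<in> edges (del_edge G {a, b})"
    then have V: "u \<in> verts G" "v \<in> verts G" "{f u, f v} \<in> edges G13" "{u, v} \<noteq> {a, b}" using f(2)
      by (auto simp: del_edge_def)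
    have inj: "inj_on f (verts G)" using f(1) by (simp add: bij_betw_def)
    show "arc 0 (f u) \<noteq> arc 0 (f v)"
    proof
      assume "arc 0 (f u) = arc 0 (f v)"
      then have "{f u, f v} = {0, step 0}" using V(3) by (intro arc_near) (auto simp: edges_G13)
      then have "f ` {u, v} = f ` {a, b}" using ab by (simp add: step_def)
      then show False using inj_on_image_eq_iff[OF inj, of "{u, v}" "{a, b}"] V ab by auto
    qed
  qed (rule arc_less)
  ultimately show ?thesis using chromatic_le by blast
qed

theorem theorem1p1:
  shows
    "(simple_graph G13 \<and> card (verts G13) = 13 \<and> regular 6 G13 \<and> vertex_critical 4 G13 \<and>
      (\<forall>G :: 'a ugraph. simple_graph G \<and> regular 6 G \<and> vertex_critical 4 G \<and>
         card (verts G) \<le> 15 \<longrightarrow> isomorphic G G13) \<and>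
      (\<not> (\<exists>G :: 'a ugraph. simple_graph G \<and> regular 6 G \<and> vertex_critical 4 G \<and>
         card (verts G) \<le> 15 \<and> card (verts G) \<noteq> 13)) \<and>
      (\<forall>(G :: 'a ugraph) (H :: 'a ugraph).
         simple_graph G \<and> regular 6 G \<and> vertex_critical 4 G \<and> card (verts G) = 13 \<and>
         simple_graph H \<and> regular 6 H \<and> vertex_critical 4 H \<and> card (verts H) = 13 \<longrightarrow>
         isomorphic G H)) \<and>
     (card (critical_edges G13) = 13 \<and> hamilton_cycle G13 (critical_edges G13)) \<and>
     (\<forall>G :: 'a ugraph. simple_graph G \<and> regular 6 G \<and> graph_4_1 G \<longrightarrow>
        card (verts G) \<ge> 16)"
proof (intro conjI allI impI notI)
  fix G H :: "'a ugraph"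
  assume "simple_graph G \<and> regular 6 G \<and> vertex_critical 4 G \<and> card (verts G) = 13 \<and>
    simple_graph H \<and> regular 6 H \<and> vertex_critical 4 H \<and> card (verts H) = 13"
  then have "isomorphic G G13" "isomorphic H G13" by (simp_all add: small_critical_isomorphic)
  then show "isomorphic G H" by (rule isomorphic_via_G13)
next
  fix G :: "'a ugraph"
  assume G: "simple_graph G \<and> regular 6 G \<and> graph_4_1 G"
  show "16 \<le> card (verts G)"
  proof (rule ccontr)
    assume "\<not> 16 \<le> card (verts G)"
    moreover have "vertex_critical 4 G" using G by (simp add: vertex_critical_def graph_4_1_def)
    ultimately have "isomorphic G G13" using G by (intro small_critical_isomorphic) simp_all
    then obtain e where "e \<in> edges G" "chromatic_number (del_edge G e) \<le> 3"
      using isomorphic_G13_critical_edge G by blast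
    then show False using G by (simp add: graph_4_1_def)
  qed
next
  assume "\<exists>G :: 'a ugraph. simple_graph G \<and> regular 6 G \<and> vertex_critical 4 G \<and>
         card (verts G) \<le> 15 \<and> card (verts G) \<noteq> 13"
  then show False using small_critical_isomorphic isomorphic_card by blast
next
  fix G :: "'a ugraph"
  assume "simple_graph G \<and> regular 6 G \<and> vertex_critical 4 G \<and> card (verts G) \<le> 15"
  then show "isomorphic G G13" using small_critical_isomorphic by blast
next
  show "card (verts G13) = 13" by (simp add: verts_G13)
qed (rule simple_G13 regular_G13 vertex_critical_G13 card_critical_edges_G13 hamilton_cycle_G13)+

end
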